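(* Let $c\ge0$, $p>1$, $\alpha\ge3$, $\beta\ge0$ be constants with $\alpha>\beta+3$, let $t_0\ge1$, and let $$\alpha(t)=\frac{\alpha}{t}+\frac{c}{t^p},\qquad \beta(t)=t^\beta,\qquad \frac{1}{\alpha-1}<\theta<\frac{1}{\beta+2}.$$ Suppose that $\epsilon:[t_0,+\infty)\to(0,+\infty)$ is a nonincreasing $\mathcal{C}^1$ function with $\lim_{t\to+\infty}\epsilon(t)=0$, and let $(x(t),y(t))$ be a global solution of the system (GTRD) (see context) with these coefficients. Then, for any fixed $(x^*,y^* )\in\Omega$: (1) If $\int_{t_0}^{+\infty}t^{\beta+1}\epsilon(t)\,\mathrm{d}t<+\infty$, then the trajectory $(x(t),y(t))$ is bounded and, as $t\to+\infty$, $$\mathcal{L}(x(t),y^* )-\mathcal{L}(x^*,y(t))=\mathcal{O}(t^{-\beta-2}),\qquad \|\dot x(t)\|=\mathcal{O}\left(\tfrac1t\right),\qquad \|\dot y(t)\|=\mathcal{O}\left(\tfrac1t\right),$$ $$\|\nabla f(x(t))-\nabla f(x^* )\|=\mathcal{O}\left(t^{-\frac{\beta+2}{2}}\right),\qquad \|\nabla g(y(t))-\nabla g(y^* )\|=\mathcal{O}\left(t^{-\frac{\beta+2}{2}}\right),$$ and moreover $$\int_{t_0}^{+\infty}t\left(\|\dot x(t)\|^2+\|\dot y(t)\|^2\right)\mathrm{d}t<+\infty,\qquad \int_{t_0}^{+\infty}t^{\beta+1}\left(\mathcal{L}(x(t),y^* )-\mathcal{L}(x^*,y(t))\right)\mathrm{d}t<+\infty,$$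 $$\int_{t_0}^{+\infty}t^{\beta+1}\|\nabla f(x(t))-\nabla f(x^* )\|^2\,\mathrm{d}t<+\infty,\qquad \int_{t_0}^{+\infty}t^{\beta+1}\|\nabla g(y(t))-\nabla g(y^* )\|^2\,\mathrm{d}t<+\infty.$$ (2) If $\int_{t_0}^{+\infty}t^{\beta-1}\epsilon(t)\,\mathrm{d}t<+\infty$, then (a) $\lim_{t\to+\infty}\|\dot x(t)\|=0$ and $\lim_{t\to+\infty}\|\dot y(t)\|=0$; (b) $\lim_{t\to+\infty}\left(\mathcal{L}(x(t),y^* )-\mathcal{L}(x^*,y(t))\right)=0$. In particular, when $\beta>0$, one has $\mathcal{L}(x(t),y^* )-\mathcal{L}(x^*,y(t))=o(t^{-\beta})$, $\|\nabla f(x(t))-\nabla f(x^* )\|=o(t^{-\beta/2})$ and $\|\nabla g(y(t))-\nabla g(y^* )\|=o(t^{-\beta/2})$ as $t\to+\infty$.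
   Context: Standing assumption: $f:\mathbb{R}^n\to\mathbb{R}$ and $g:\mathbb{R}^m\to\mathbb{R}$ are continuously differentiable convex functions whose gradients $\nabla f$, $\nabla g$ are $L_1$- and $L_2$-Lipschitz continuous, respectively, with $L_1,L_2>0$; $K\in\mathbb{R}^{m\times n}$ with adjoint $K^*$. Norms and inner products are Euclidean. The letters $\alpha,\beta$ denote constants, while $\alpha(t),\beta(t)$ denote the coefficient functions. Lagrangian: $\mathcal{L}(x,y)=f(x)+\langle Kx,y\rangle-g(y)$ on $\mathbb{R}^n\times\mathbb{R}^m$. A pair $(x^*,y^* )$ is a saddle point of $\mathcal{L}$ if $\mathcal{L}(x^*,y)\le\mathcal{L}(x^*,y^* )\le\mathcal{L}(x,y^* )$ for all $(x,y)\in\mathbb{R}^n\times\mathbb{R}^m$; $\Omega$ is the set of saddle points. Regularized function: $\mathcal{L}_t(x,y)=\mathcal{L}(x,y)+\frac{\epsilon(t)}{2}(\|x\|^2-\|y\|^2)$. System (GTRD), for $t\ge t_0$: $$\ddot x(t)+\alpha(t)\dot x(t)+\beta(t)\nabla_x\mathcal{L}_t\big(x(t),y(t)+\theta t\dot y(t)\big)=0,$$ $$\ddot y(t)+\alpha(t)\dot y(t)-\beta(t)\nabla_y\mathcal{L}_t\big(x(t)+\theta t\dot x(t),y(t)\big)=0,$$ where $\nabla_x\mathcal{L}_t(x,y)=\nabla f(x)+K^*y+\epsilon(t)x$ and $\nabla_y\mathcal{L}_t(x,y)=-\nabla g(y)+Kx-\epsilon(t)y$. A global solution is a global strong solution: $x\in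 W^{2,1}_{\mathrm{loc}}([t_0,+\infty);\mathbb{R}^n)$, $y\in W^{2,1}_{\mathrm{loc}}([t_0,+\infty);\mathbb{R}^m)$, satisfying the system for almost every $t>t_0$. *)

theory Defs
  imports "HOL-Analysis.Analysis" "HOL-Library.Landau_Symbols"
begin

definition grad :: "('a::euclidean_space \<Rightarrow> real) \<Rightarrow> 'a \<Rightarrow> 'a" where
  "grad h u = (THE D. GDERIV h u :> D)"

lemma grad_eqI:
  assumes "GDERIV h u :> D"
  shows "grad h u = D"
  unfolding grad_def
proof (rule the_equality)
  fix D' assume "GDERIV h u :> D'"
  then have "(\<lambda>k. k \<bullet> D') = (\<lambda>k. k \<bullet> D)"
    using assms unfolding gderiv_def by (rule has_derivative_unique)
  then show "D' = D"
    by (metis euclidean_eqI inner_commute)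
qed (fact assms)

lemma differentiable_imp_GDERIV_grad:
  assumes "h differentiable (at u)"
  shows "GDERIV h u :> grad h u"
proof -
  obtain h' where h': "(h has_derivative h') (at u)"
    using assms unfolding differentiable_def by blast
  have lin: "linear h'" using h' by (rule has_derivative_linear)
  have "h' = (\<lambda>k. k \<bullet> adjoint h' 1)"
    using adjoint_works[OF lin, of _ "1::real"] by (auto simp: fun_eq_iff)
  then have "GDERIV h u :> adjoint h' 1" using h' unfolding gderiv_def by simp
  then show ?thesis using grad_eqI by fastforce
qed

definition lagrangian ::
  "(real^'n \<Rightarrow> real) \<Rightarrow> (real^'m \<Rightarrow> real) \<Rightarrow> real^'n^'m \<Rightarrow> real^'n \<Rightarrow> real^'m \<Rightarrow> real" where
  "lagrangian f g K u v = f u + (K *v u) \<bullet> v - g v"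

definition saddle_points ::
  "(real^'n \<Rightarrow> real) \<Rightarrow> (real^'m \<Rightarrow> real) \<Rightarrow> real^'n^'m \<Rightarrow> ((real^'n) \<times> (real^'m)) set" where
  "saddle_points f g K = {(us, vs). \<forall>u v.
     lagrangian f g K us v \<le> lagrangian f g K us vs \<and>
     lagrangian f g K us vs \<le> lagrangian f g K u vs}"

definition reg_lagrangian ::
  "(real^'n \<Rightarrow> real) \<Rightarrow> (real^'m \<Rightarrow> real) \<Rightarrow> real^'n^'m \<Rightarrow> (real \<Rightarrow> real) \<Rightarrow>
   real \<Rightarrow> real^'n \<Rightarrow> real^'m \<Rightarrow> real" where
  "reg_lagrangian f g K eps t u v =
     lagrangian f g K u v + eps t / 2 * ((norm u)\<^sup>2 - (norm v)\<^sup>2)"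

lemma grad_x_reg_lagrangian:
  assumes "f differentiable (at u)"
  shows "grad (\<lambda>w. reg_lagrangian f g K eps t w v) u
           = grad f u + adjoint (\<lambda>w. K *v w) v + eps t *\<^sub>R u"
proof (rule grad_eqI)
  have d: "(f has_derivative (\<lambda>k. k \<bullet> grad f u)) (at u)"
    using differentiable_imp_GDERIV_grad[OF assms] unfolding gderiv_def .
  have a: "(K *v k) \<bullet> v = k \<bullet> adjoint (\<lambda>w. K *v w) v" for k
    using adjoint_works[of "(*v) K" k v] by (simp add: matrix_vector_mul_linear)
  show "GDERIV (\<lambda>w. reg_lagrangian f g K eps t w v) u
          :> (grad f u + adjoint (\<lambda>w. K *v w) v + eps t *\<^sub>R u)"
    unfolding gderiv_def reg_lagrangian_def lagrangian_def a power2_norm_eq_inner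
    by (rule derivative_eq_intros d refl
          | simp add: inner_add_right inner_commute fun_eq_iff algebra_simps)+
qed

lemma grad_y_reg_lagrangian:
  assumes "g differentiable (at v)"
  shows "grad (\<lambda>w. reg_lagrangian f g K eps t u w) v
           = - grad g v + K *v u - eps t *\<^sub>R v"
proof (rule grad_eqI)
  have d: "(g has_derivative (\<lambda>k. k \<bullet> grad g v)) (at v)"
    using differentiable_imp_GDERIV_grad[OF assms] unfolding gderiv_def .
  show "GDERIV (\<lambda>w. reg_lagrangian f g K eps t u w) v
          :> (- grad g v + K *v u - eps t *\<^sub>R v)"
    unfolding gderiv_def reg_lagrangian_def lagrangian_def power2_norm_eq_inner
    by (rule derivative_eq_intros d refl
          | simp add: inner_add_right inner_diff_right inner_commute fun_eq_iff algebra_simps)+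
qed

definition L1_loc :: "real \<Rightarrow> (real \<Rightarrow> 'a::euclidean_space) \<Rightarrow> bool" where
  "L1_loc t0 u \<longleftrightarrow> (\<forall>T\<ge>t0. set_integrable lebesgue {t0..T} u)"

text \<open>Test functions are \<open>C\<^sup>1\<close> with compact support in the open half-line, the usual
  convention for Sobolev spaces in one variable (Brezis, Functional Analysis, Sobolev Spaces
  and PDEs, Section 8.2).\<close>

definition test_function :: "real \<Rightarrow> (real \<Rightarrow> real) \<Rightarrow> bool" where
  "test_function t0 \<phi> \<longleftrightarrow> \<phi> C1_differentiable_on UNIV \<and>
     compact (closure {t. \<phi> t \<noteq> 0}) \<and> closure {t. \<phi> t \<noteq> 0} \<subseteq> {t0<..}"

definition weak_derivative ::
  "real \<Rightarrow> (real \<Rightarrow> 'a::euclidean_space) \<Rightarrow> (real \<Rightarrow> 'a) \<Rightarrow> bool" where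
  "weak_derivative t0 u v \<longleftrightarrow> (\<forall>\<phi>. test_function t0 \<phi> \<longrightarrow>
     (LINT t:{t0<..}|lebesgue. deriv \<phi> t *\<^sub>R u t) = - (LINT t:{t0<..}|lebesgue. \<phi> t *\<^sub>R v t))"

text \<open>\<open>W21_loc t0 u u' u''\<close>: the function \<open>u\<close> belongs to the Sobolev space
  \<open>W\<^sup>2\<^sup>,\<^sup>1\<close>, locally on \<open>[t0, \<infinity>)\<close>, with weak derivatives \<open>u'\<close> and \<open>u''\<close>.\<close>

definition W21_loc ::
  "real \<Rightarrow> (real \<Rightarrow> 'a::euclidean_space) \<Rightarrow> (real \<Rightarrow> 'a) \<Rightarrow> (real \<Rightarrow> 'a) \<Rightarrow> bool" where
  "W21_loc t0 u u' u'' \<longleftrightarrow> L1_loc t0 u \<and> L1_loc t0 u' \<and> L1_loc t0 u'' \<and>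
     weak_derivative t0 u u' \<and> weak_derivative t0 u' u''"

text \<open>Elements of the Sobolev space are classes modulo null sets. As pointwise values of
  \<open>x\<close>, \<open>y\<close> and of the velocities \<open>x'\<close>, \<open>y'\<close> are used, these
  four functions are taken to be the continuous representatives, which exist and are unique on
  \<open>[t0, \<infinity>)\<close>; then \<open>x'\<close> and \<open>y'\<close> are the classical derivatives of
  \<open>x\<close> and \<open>y\<close>. The accelerations are only determined almost everywhere.
  The arguments \<open>a\<close> and \<open>b\<close> are the coefficient functions of the velocity and
  of the gradient.\<close>

definition GTRD_solution ::
  "(real^'n \<Rightarrow> real) \<Rightarrow> (real^'m \<Rightarrow> real) \<Rightarrow> real^'n^'m \<Rightarrow>
   (real \<Rightarrow> real) \<Rightarrow> (real \<Rightarrow> real) \<Rightarrow> (real \<Rightarrow> real) \<Rightarrow> real \<Rightarrow> real \<Rightarrow>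
   (real \<Rightarrow> real^'n) \<Rightarrow> (real \<Rightarrow> real^'n) \<Rightarrow> (real \<Rightarrow> real^'m) \<Rightarrow> (real \<Rightarrow> real^'m) \<Rightarrow> bool" where
  "GTRD_solution f g K a b eps \<theta> t0 x x' y y' \<longleftrightarrow>
     continuous_on {t0..} x \<and> continuous_on {t0..} x' \<and>
     continuous_on {t0..} y \<and> continuous_on {t0..} y' \<and>
     (\<exists>x'' y''. W21_loc t0 x x' x'' \<and> W21_loc t0 y y' y'' \<and>
       (AE t in lebesgue. t0 < t \<longrightarrow>
          x'' t + a t *\<^sub>R x' t
            + b t *\<^sub>R grad (\<lambda>u. reg_lagrangian f g K eps t u (y t + (\<theta> * t) *\<^sub>R y' t)) (x t) = 0 \<and>
          y'' t + a t *\<^sub>R y' t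
            - b t *\<^sub>R grad (\<lambda>v. reg_lagrangian f g K eps t (x t + (\<theta> * t) *\<^sub>R x' t) v) (y t) = 0))"

end

theory Submission
  imports Defs
begin

text \<open>The proof rests on a Lyapunov function. Let \<open>F\<close> and \<open>G\<close> be the Bregman divergences of \<open>f\<close> and
  \<open>g\<close> with base points \<open>xs\<close> and \<open>ys\<close>. At a saddle point the gap
  \<open>lagrangian f g K (x t) ys - lagrangian f g K xs (y t)\<close> is \<open>F (x t) + G (y t)\<close>, and subtracting
  the optimality conditions from the equations replaces \<open>grad f\<close>, \<open>grad g\<close> by the gradients of
  \<open>F\<close>, \<open>G\<close>. Let \<open>m = \<theta> * (\<alpha> - 1) - 1\<close>, which is positive, and let \<open>E t\<close> be the sum of
  \<open>\<theta>\<^sup>2 * t powr (\<beta> + 2) * (F (x t) + eps t / 2 * (norm (x t))\<^sup>2)\<close>,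
  \<open>(norm (x t - xs + (\<theta> * t) *\<^sub>R x' t))\<^sup>2 / 2\<close> and
  \<open>(m + \<theta> * c * t powr (1 - p)) / 2 * (norm (x t - xs))\<^sup>2\<close>, together with the same terms for
  \<open>y\<close>.

  Differentiating \<open>E\<close> along a solution, the coupling terms cancel, because the extrapolated points in
  the system are the ones that occur in \<open>E\<close>. The cocoercivity inequality
  \<open>bregman_add_grad_diff_square_le_inner\<close> and \<open>\<theta> * (\<beta> + 2) < 1\<close> then yield
  \<open>E' t + W t \<le> \<theta> / 2 * ((norm xs)\<^sup>2 + (norm ys)\<^sup>2) * t powr (\<beta> + 1) * eps t\<close>, where \<open>W\<close> is a
  combination with positive coefficients of \<open>t\<close> times the squared velocities and of
  \<open>t powr (\<beta> + 1)\<close> times the gap and the squared gradient differences. This is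
  \<open>block_energy_derivative\<close>, applied to each of the two variables.

  If \<open>t powr (\<beta> + 1) * eps t\<close> is integrable, then \<open>E\<close> and the integral of \<open>W\<close> are bounded, which gives
  all rates and integrability claims of the first part. If only \<open>t powr (\<beta> - 1) * eps t\<close> is
  integrable, then \<open>E t / t\<^sup>2\<close> tends to \<open>0\<close> by \<open>integral_square_weight_tendsto_0\<close>, which gives the
  second part.

  All this is calculus for classical solutions. The continuity assumptions make it applicable: a
  continuous function with a continuous weak derivative is continuously differentiable
  (\<open>weak_derivative_imp_has_vector_derivative\<close>), and by the equations the accelerations are continuous
  up to a null set.\<close>

section \<open>From weak to classical derivatives\<close>

text \<open>The test functions are built from the quadratic B-spline: \<open>step\<close> is a \<open>C\<^sup>1\<close> transition from
  \<open>0\<close> to \<open>1\<close> on \<open>[0, 2]\<close>, whose derivative \<open>hat\<close> is the tent function on \<open>[0, 2]\<close>. Writing both as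
  combinations of shifts of \<open>ramp\<close> and its square makes differentiability at the knots
  automatic.\<close>

text \<open>The positive part.\<close>
definition ramp :: "real \<Rightarrow> real" where
  "ramp s = max 0 s"

text \<open>The tent of height \<open>1\<close> over \<open>[0, 2]\<close>, as the second difference of the positive part.\<close>
definition hat :: "real \<Rightarrow> real" where
  "hat s = ramp s - 2 * ramp (s - 1) + ramp (s - 2)"

text \<open>The primitive of \<open>hat\<close> vanishing on the left, as a second difference of squared positive
  parts.\<close>
definition step :: "real \<Rightarrow> real" where
  "step s = ((ramp s)\<^sup>2 - 2 * (ramp (s - 1))\<^sup>2 + (ramp (s - 2))\<^sup>2) / 2"

lemma ramp_square_deriv: "((\<lambda>s. (ramp s)\<^sup>2) has_real_derivative 2 * ramp s) (at s)"
proof (cases "s = 0")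
  case True
  have "((\<lambda>h::real. max 0 h) \<longlongrightarrow> max 0 0) (at 0)"
    by (intro tendsto_intros)
  then have *: "(ramp \<longlongrightarrow> 0) (at 0)" by (simp add: ramp_def[abs_def])
  have "(\<lambda>h. ((ramp (0 + h))\<^sup>2 - (ramp 0)\<^sup>2) / h) = ramp"
    by (auto simp: ramp_def fun_eq_iff max_def power2_eq_square)
  then show ?thesis using * True unfolding DERIV_def by (simp add: ramp_def)
next
  case False
  show ?thesis
  proof (cases "s > 0")
    case True
    have "((\<lambda>s. s\<^sup>2) has_real_derivative 2 * s) (at s)"
      by (auto intro!: derivative_eq_intros)
    moreover have "eventually (\<lambda>r. r \<in> {0<..}) (nhds s)"
      using True by (intro eventually_nhds_in_open) auto
    then have "eventually (\<lambda>r. (ramp r)\<^sup>2 = r\<^sup>2) (nhds s)"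
      by eventually_elim (simp add: ramp_def)
    ultimately show ?thesis using True
      by (subst DERIV_cong_ev[OF refl _ refl]) (auto simp: ramp_def)
  next
    case False
    then have "s < 0" using \<open>s \<noteq> 0\<close> by simp
    then have "eventually (\<lambda>r. r \<in> {..<0}) (nhds s)"
      by (intro eventually_nhds_in_open) auto
    then have "eventually (\<lambda>r. (ramp r)\<^sup>2 = 0) (nhds s)"
      by eventually_elim (simp add: ramp_def)
    moreover have "((\<lambda>s. 0) has_real_derivative 2 * ramp s) (at s)"
      using False by (simp add: ramp_def)
    ultimately show ?thesis
      by (subst DERIV_cong_ev[OF refl _ refl])
  qed
qed

lemma step_deriv: "(step has_real_derivative hat s) (at s)"
proof -
  have "((\<lambda>s. (ramp (s - c))\<^sup>2) has_real_derivative 2 * ramp (s - c)) (at s)" for c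
  proof -
    have "((\<lambda>s. s - c) has_real_derivative 1) (at s)" by (auto intro!: derivative_eq_intros)
    from DERIV_chain2[OF ramp_square_deriv this] show ?thesis by simp
  qed
  note d = this
  have "((\<lambda>s. ((ramp (s - 0))\<^sup>2 - 2 * (ramp (s - 1))\<^sup>2 + (ramp (s - 2))\<^sup>2) / 2) has_real_derivative
      (2 * ramp (s - 0) - 2 * (2 * ramp (s - 1)) + 2 * ramp (s - 2)) / 2) (at s)"
    by (intro DERIV_cdivide DERIV_add DERIV_diff DERIV_cmult d)
  moreover have "step = (\<lambda>s. ((ramp (s - 0))\<^sup>2 - 2 * (ramp (s - 1))\<^sup>2 + (ramp (s - 2))\<^sup>2) / 2)"
    by (simp add: fun_eq_iff step_def)
  ultimately show ?thesis
    by (simp only: hat_def) (erule DERIV_cong, simp)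
qed

lemma continuous_hat [continuous_intros]:
  "continuous_on A h \<Longrightarrow> continuous_on A (\<lambda>t. hat (h t))"
  unfolding hat_def ramp_def by (intro continuous_intros)

lemma hat_bounds: "0 \<le> hat s" "hat s \<le> 1" and hat_outside: "s \<notin> {0..2} \<Longrightarrow> hat s = 0"
  by (auto simp: hat_def ramp_def max_def)

lemma step_left: "s \<le> 0 \<Longrightarrow> step s = 0" and step_right: "s \<ge> 2 \<Longrightarrow> step s = 1"
  by (auto simp: step_def ramp_def max_def power2_eq_square algebra_simps)

lemma step_bounds: "0 \<le> step s" "step s \<le> 1"
proof -
  have mono: "r \<le> s \<Longrightarrow> step r \<le> step s" for r s
    by (rule DERIV_nonneg_imp_nondecreasing) (use step_deriv hat_bounds in blast)+
  show "0 \<le> step s" using mono[of "min s 0" s] by (simp add: step_left)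
  show "step s \<le> 1" using mono[of s "max s 2"] by (simp add: step_right)
qed

lemma hat_integral: "integrable lborel hat" "integral\<^sup>L lborel hat = 1"
proof -
  have hat_cont: "continuous_on UNIV hat" by (intro continuous_hat[of _ "\<lambda>s. s"] continuous_on_id)
  have "has_bochner_integral lborel (\<lambda>s. hat s * indicator {0..2} s) (step 2 - step 0)"
    by (rule has_bochner_integral_FTC_Icc_real)
       (use hat_cont in \<open>auto intro: step_deriv simp: continuous_on_eq_continuous_at\<close>)
  moreover have "(\<lambda>s. hat s * indicator {0..2} s) = hat"
    using hat_outside by (auto simp: fun_eq_iff indicator_def)
  ultimately have "has_bochner_integral lborel hat 1"
    by (simp add: step_left step_right)
  then show "integrable lborel hat" "integral\<^sup>L lborel hat = 1"
    by (auto simp: has_bochner_integral_iff)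
qed

text \<open>The rescaled tents \<open>N * hat (N * (t - a))\<close> form an approximate identity that is concentrated to
  the right of \<open>a\<close>. After the substitution \<open>t = a + s / N\<close> the limit is a case of dominated
  convergence.\<close>
lemma hat_mollification_tendsto:
  fixes u :: "real \<Rightarrow> 'a::euclidean_space"
  assumes u: "continuous_on {t0<..} u" and a: "t0 < a"
  shows "(\<lambda>n. LINT t:{t0<..}|lebesgue. (real (Suc n) * hat (real (Suc n) * (t - a))) *\<^sub>R u t) \<longlonglongrightarrow> u a"
proof -
  \<comment> \<open>Extension by zero: \<open>u\<close> is not assumed measurable outside \<open>{t0<..}\<close>.\<close>
  define w where "w t = indicator {t0<..} t *\<^sub>R u t" for t
  have w_meas: "w \<in> borel_measurable borel"
    unfolding w_def using u by (intro borel_measurable_continuous_on_indicator) auto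
  have hat_meas: "hat \<in> borel_measurable borel"
    by (intro borel_measurable_continuous_onI continuous_intros)
  have w_cont: "isCont w a"
  proof -
    have "isCont u a" using u a by (simp add: continuous_on_eq_continuous_at)
    moreover have "eventually (\<lambda>t. t \<in> {t0<..}) (nhds a)"
      using a by (intro eventually_nhds_in_open) auto
    then have "eventually (\<lambda>t. w t = u t) (nhds a)"
      by eventually_elim (simp add: w_def)
    ultimately show ?thesis by (subst isCont_cong)
  qed
  obtain M where M: "\<And>t. t \<in> {a..a+2} \<Longrightarrow> norm (u t) \<le> M"
  proof -
    have "compact (u ` {a..a+2})"
      using a by (intro compact_continuous_image continuous_on_subset[OF u]) auto
    then have "bounded (u ` {a..a+2})" by (rule compact_imp_bounded)
    then show ?thesis using that unfolding bounded_iff by blast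
  qed
  have eq: "(LINT t:{t0<..}|lebesgue. (N * hat (N * (t - a))) *\<^sub>R u t)
      = (LINT s|lborel. hat s *\<^sub>R w (a + s / N))" if "N > 0" for N
  proof -
    have "(LINT t:{t0<..}|lebesgue. (N * hat (N * (t - a))) *\<^sub>R u t)
        = (LINT t|lebesgue. (N * hat (N * (t - a))) *\<^sub>R w t)"
      unfolding set_lebesgue_integral_def w_def by (simp add: mult.commute)
    also have "\<dots> = (LINT t|lborel. (N * hat (N * (t - a))) *\<^sub>R w t)"
    proof (intro integral_completion)
      have "(\<lambda>t. hat (N * (t - a))) \<in> borel_measurable borel"
        by (intro borel_measurable_continuous_onI continuous_intros)
      then show "(\<lambda>t. (N * hat (N * (t - a))) *\<^sub>R w t) \<in> borel_measurable lborel"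
        using w_meas by simp
    qed
    also have "\<dots> = \<bar>1 / N\<bar> *\<^sub>R (LINT s|lborel. (N * hat (N * (a + 1 / N * s - a))) *\<^sub>R w (a + 1 / N * s))"
      using that by (intro lborel_integral_real_affine) auto
    also have "\<dots> = (LINT s|lborel. hat s *\<^sub>R w (a + s / N))"
      using that by (simp flip: integral_scaleR_right)
    finally show ?thesis .
  qed
  have "(\<lambda>n. LINT s|lborel. hat s *\<^sub>R w (a + s / real (Suc n))) \<longlonglongrightarrow> (LINT s|lborel. hat s *\<^sub>R w a)"
  proof (rule integral_dominated_convergence)
    show "integrable lborel (\<lambda>s. hat s * M)" using hat_integral by simp
    show "AE s in lborel. norm (hat s *\<^sub>R w (a + s / real (Suc n))) \<le> hat s * M" for n
    proof (rule AE_I2)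
      fix s
      show "norm (hat s *\<^sub>R w (a + s / real (Suc n))) \<le> hat s * M"
      proof (cases "s \<in> {0..2}")
        case True
        then have "s / real (Suc n) \<le> s / 1" by (intro divide_left_mono) auto
        then have "a + s / real (Suc n) \<in> {a..a+2}" using True by auto
        then have "norm (w (a + s / real (Suc n))) \<le> M"
          using M[of "a + s / real (Suc n)"] a by (auto simp: w_def indicator_def)
        then show ?thesis using hat_bounds[of s] by (simp add: mult_left_mono)
      qed (simp add: hat_outside)
    qed
    show "AE s in lborel. (\<lambda>n. hat s *\<^sub>R w (a + s / real (Suc n))) \<longlonglongrightarrow> hat s *\<^sub>R w a"
    proof (rule AE_I2)
      fix s
      have "(\<lambda>n. s / real (Suc n)) \<longlonglongrightarrow> 0" by (rule LIMSEQ_Suc) (rule lim_const_over_n)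
      then have "(\<lambda>n. a + s / real (Suc n)) \<longlonglongrightarrow> a + 0" by (intro tendsto_intros)
      then show "(\<lambda>n. hat s *\<^sub>R w (a + s / real (Suc n))) \<longlonglongrightarrow> hat s *\<^sub>R w a"
        using w_cont by (intro tendsto_intros isCont_tendsto_compose[of _ w]) auto
    qed
    show "(\<lambda>s. hat s *\<^sub>R w a) \<in> borel_measurable lborel"
      using hat_meas by simp
    show "(\<lambda>s. hat s *\<^sub>R w (a + s / real (Suc n))) \<in> borel_measurable lborel" for n
      using hat_meas measurable_compose[OF _ w_meas, of "\<lambda>s. a + s / real (Suc n)" borel] by simp
  qed
  then have "(\<lambda>n. LINT s|lborel. hat s *\<^sub>R w (a + s / real (Suc n))) \<longlonglongrightarrow> u a"
    using hat_integral a by (simp add: w_def)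
  then show ?thesis by (simp only: eq of_nat_0_less_iff zero_less_Suc)
qed

text \<open>A \<open>C\<^sup>1\<close> approximation, with transition width \<open>2 / N\<close>, of the indicator function of the interval
  from \<open>a\<close> to \<open>b\<close>.\<close>
definition plateau :: "real \<Rightarrow> real \<Rightarrow> real \<Rightarrow> real \<Rightarrow> real" where
  "plateau N a b t = step (N * (t - a)) - step (N * (t - b))"

lemma plateau_deriv:
  "(plateau N a b has_real_derivative N * hat (N * (t - a)) - N * hat (N * (t - b))) (at t)"
proof -
  have "((\<lambda>t. step (N * (t - c))) has_real_derivative N * hat (N * (t - c))) (at t)" for c
  proof -
    have "((\<lambda>t. N * (t - c)) has_real_derivative N) (at t)" by (auto intro!: derivative_eq_intros)
    from DERIV_chain2[OF step_deriv this] show ?thesis by (simp add: mult.commute)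
  qed
  from this[of a] this[of b] show ?thesis
    unfolding plateau_def[abs_def] by (auto intro!: derivative_eq_intros)
qed

lemma plateau_outside:
  assumes "N \<ge> 1" "a \<le> b" "t \<notin> {a..b+2}"
  shows "plateau N a b t = 0"
proof -
  consider "t < a" | "t > b + 2" using assms by force
  then show ?thesis
  proof cases
    case 1
    then have "N * (t - a) \<le> 0" "N * (t - b) \<le> 0" using assms by (auto simp: mult_le_0_iff)
    then show ?thesis by (simp add: plateau_def step_left)
  next
    case 2
    then have "N * (t - a) \<ge> 1 * 2" "N * (t - b) \<ge> 1 * 2"
      using assms by (intro mult_mono; simp)+
    then show ?thesis by (simp add: plateau_def step_right)
  qed
qed

lemma test_function_plateau:
  assumes "N \<ge> 1" "t0 < a" "a \<le> b"
  shows "test_function t0 (plateau N a b)"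
proof -
  have "{t. plateau N a b t \<noteq> 0} \<subseteq> {a..b+2}"
    using plateau_outside[OF assms(1,3)] by blast
  then have sub: "closure {t. plateau N a b t \<noteq> 0} \<subseteq> {a..b+2}"
    by (intro closure_minimal) auto
  have "plateau N a b C1_differentiable_on UNIV"
    unfolding C1_differentiable_on_def
    using plateau_deriv[unfolded has_real_derivative_iff_has_vector_derivative]
    by (intro exI[of _ "\<lambda>t. N * hat (N * (t - a)) - N * hat (N * (t - b))"])
       (auto intro!: continuous_intros)
  moreover have "compact (closure {t. plateau N a b t \<noteq> 0})"
    using bounded_subset[OF bounded_closed_interval sub] by (simp add: compact_eq_bounded_closed)
  ultimately show ?thesis
    using sub assms by (auto simp: test_function_def)
qed

lemma plateau_tendsto:
  "(\<lambda>n. plateau (real (Suc n)) a b t) \<longlonglongrightarrow> indicator {a<..} t - indicator {b<..} t"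
proof -
  have "(\<lambda>n. step (real (Suc n) * (t - c))) \<longlonglongrightarrow> indicator {c<..} t" for c
  proof (cases "t > c")
    case True
    have "filterlim (\<lambda>n. real (Suc n) * (t - c)) at_top sequentially"
      using True by (intro filterlim_at_top_mult_tendsto_pos[where c = "t - c"] tendsto_const
        filterlim_compose[OF filterlim_real_sequentially filterlim_Suc]) auto
    then have "eventually (\<lambda>n. real (Suc n) * (t - c) \<ge> 2) sequentially"
      by (simp add: filterlim_at_top)
    then have "eventually (\<lambda>n. step (real (Suc n) * (t - c)) = 1) sequentially"
      by eventually_elim (simp add: step_right)
    then show ?thesis using True by (simp add: tendsto_eventually)
  next
    case False
    then have "real (Suc n) * (t - c) \<le> 0" for n by (intro mult_nonneg_nonpos) auto
    then show ?thesis using False by (simp add: step_left)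
  qed
  then show ?thesis unfolding plateau_def by (intro tendsto_intros)
qed

lemma set_integrable_lebesgue_continuous:
  fixes u :: "real \<Rightarrow> 'a::euclidean_space"
  assumes "continuous_on {a..b} u"
  shows "set_integrable lebesgue {a..b} u"
  using assms absolutely_integrable_continuous_real by auto

text \<open>Testing with \<open>plateau N a b\<close> and letting \<open>N\<close> tend to infinity turns the definition of the weak
  derivative into the fundamental theorem of calculus: the left-hand side tends to
  \<open>u a - u b\<close>, the right-hand side to minus the integral of \<open>v\<close> over \<open>(a, b]\<close>.\<close>
lemma weak_derivative_imp_integral:
  fixes u v :: "real \<Rightarrow> 'a::euclidean_space"
  assumes u: "continuous_on {t0<..} u" and v: "continuous_on {t0<..} v"
    and weak: "weak_derivative t0 u v" and ab: "t0 < a" "a \<le> b"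
  shows "u b - u a = integral {a..b} v"
proof -
  let ?\<phi> = "\<lambda>n. plateau (real (Suc n)) a b"
  let ?k = "\<lambda>c n t. real (Suc n) * hat (real (Suc n) * (t - c))"
  have int_k: "set_integrable lebesgue {t0<..} (\<lambda>t. ?k c n t *\<^sub>R u t)" if "t0 < c" for c n
  proof -
    have "set_integrable lebesgue {c..c+2} (\<lambda>t. ?k c n t *\<^sub>R u t)"
      using that by (intro set_integrable_lebesgue_continuous continuous_intros continuous_on_subset[OF u]) auto
    moreover have "?k c n t = 0" if "t \<notin> {c..c+2}" for t
    proof -
      have "real (Suc n) * (t - c) \<notin> {0..2}"
      proof (cases "t < c")
        case True
        then have "real (Suc n) * (t - c) < 0" by (intro mult_pos_neg) auto
        then show ?thesis by auto
      next
        case False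
        then have "t - c > 2" using that by auto
        moreover then have "1 * (t - c) \<le> real (Suc n) * (t - c)" by (intro mult_right_mono) auto
        ultimately have "2 < real (Suc n) * (t - c)"
          unfolding mult_1_left by (rule less_le_trans)
        then show ?thesis by auto
      qed
      then show ?thesis by (simp add: hat_outside)
    qed
    ultimately show ?thesis
      using that unfolding set_integrable_def
      by (subst Bochner_Integration.integrable_cong[OF refl, where g = "\<lambda>t. indicator {c..c+2} t *\<^sub>R (?k c n t *\<^sub>R u t)"])
         (auto simp: indicator_def)
  qed
  have eq: "(LINT t:{t0<..}|lebesgue. ?k a n t *\<^sub>R u t) - (LINT t:{t0<..}|lebesgue. ?k b n t *\<^sub>R u t)
      = - (LINT t:{t0<..}|lebesgue. ?\<phi> n t *\<^sub>R v t)" for n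
  proof -
    have "(LINT t:{t0<..}|lebesgue. ?k a n t *\<^sub>R u t) - (LINT t:{t0<..}|lebesgue. ?k b n t *\<^sub>R u t)
        = (LINT t:{t0<..}|lebesgue. ?k a n t *\<^sub>R u t - ?k b n t *\<^sub>R u t)"
      using ab by (intro set_integral_diff(2)[symmetric] int_k) auto
    also have "\<dots> = (LINT t:{t0<..}|lebesgue. deriv (?\<phi> n) t *\<^sub>R u t)"
      by (simp only: DERIV_imp_deriv[OF plateau_deriv] scaleR_left_diff_distrib)
    also have "\<dots> = - (LINT t:{t0<..}|lebesgue. ?\<phi> n t *\<^sub>R v t)"
      using weak test_function_plateau[of "real (Suc n)" t0 a b] ab
      unfolding weak_derivative_def by auto
    finally show ?thesis .
  qed
  have "(\<lambda>n. - (LINT t:{t0<..}|lebesgue. ?\<phi> n t *\<^sub>R v t)) \<longlonglongrightarrow> u a - u b"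
    unfolding eq[symmetric] using ab by (intro tendsto_diff hat_mollification_tendsto u) auto
  from tendsto_minus[OF this]
  have lim1: "(\<lambda>n. LINT t:{t0<..}|lebesgue. ?\<phi> n t *\<^sub>R v t) \<longlonglongrightarrow> - (u a - u b)"
    by (simp only: minus_minus)
  have v_int: "set_integrable lebesgue {a..b+2} v"
    using ab by (intro set_integrable_lebesgue_continuous continuous_on_subset[OF v]) auto
  have "(\<lambda>n. LINT t|lebesgue. ?\<phi> n t *\<^sub>R (indicator {a..b+2} t *\<^sub>R v t))
      \<longlonglongrightarrow> (LINT t|lebesgue. (indicator {a<..} t - indicator {b<..} t) *\<^sub>R (indicator {a..b+2} t *\<^sub>R v t))"
  proof (rule integral_dominated_convergence)
    show "integrable lebesgue (\<lambda>t. norm (indicator {a..b+2} t *\<^sub>R v t))"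
      using v_int unfolding set_integrable_def by (rule integrable_norm)
    show "AE t in lebesgue. norm (?\<phi> n t *\<^sub>R (indicator {a..b+2} t *\<^sub>R v t)) \<le> norm (indicator {a..b+2} t *\<^sub>R v t)" for n
    proof (rule AE_I2)
      fix t
      have "\<bar>?\<phi> n t\<bar> \<le> 1"
        using step_bounds[of "real (Suc n) * (t - a)"] step_bounds[of "real (Suc n) * (t - b)"]
        unfolding plateau_def by linarith
      then show "norm (?\<phi> n t *\<^sub>R (indicator {a..b+2} t *\<^sub>R v t)) \<le> norm (indicator {a..b+2} t *\<^sub>R v t)"
        by (simp only: norm_scaleR) (intro mult_left_le_one_le, auto)
    qed
    have v_meas: "(\<lambda>t. indicator {a..b+2} t *\<^sub>R v t) \<in> borel_measurable lebesgue"
      using v_int unfolding set_integrable_def by (rule borel_measurable_integrable)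
    have "continuous_on UNIV (?\<phi> n)" for n
      using DERIV_continuous_on[OF plateau_deriv] .
    then have "?\<phi> n \<in> borel_measurable lebesgue" for n
      by (intro measurable_completion) (simp add: borel_measurable_continuous_onI)
    then show "(\<lambda>t. ?\<phi> n t *\<^sub>R (indicator {a..b+2} t *\<^sub>R v t)) \<in> borel_measurable lebesgue" for n
      by (rule borel_measurable_scaleR[OF _ v_meas])
    show "(\<lambda>t. (indicator {a<..} t - indicator {b<..} t) *\<^sub>R (indicator {a..b+2} t *\<^sub>R v t)) \<in> borel_measurable lebesgue"
      by (intro borel_measurable_scaleR[OF borel_measurable_diff v_meas] measurable_completion) auto
  qed (intro AE_I2 tendsto_intros plateau_tendsto)
  moreover have e1: "?\<phi> n t *\<^sub>R (indicator {a..b+2} t *\<^sub>R v t) = indicator {t0<..} t *\<^sub>R (?\<phi> n t *\<^sub>R v t)" for n t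
    using ab plateau_outside[of "real (Suc n)" a b t] by (auto simp: indicator_def)
  moreover have e2: "(indicator {a<..} t - indicator {b<..} t) *\<^sub>R (indicator {a..b+2} t *\<^sub>R v t)
      = indicator {a<..b} t *\<^sub>R v t" for t
    using ab by (auto simp: indicator_def)
  ultimately have lim2: "(\<lambda>n. LINT t:{t0<..}|lebesgue. ?\<phi> n t *\<^sub>R v t) \<longlonglongrightarrow> (LINT t:{a<..b}|lebesgue. v t)"
    unfolding set_lebesgue_integral_def by (simp only: e1 e2)
  have "(LINT t:{a<..b}|lebesgue. v t) = integral {a<..b} v"
    by (intro set_lebesgue_integral_eq_integral set_integrable_subset[OF v_int]) auto
  also have "\<dots> = integral {a..b} v"
    by (intro integral_subset_negligible negligible_subset[OF negligible_sing[of a]]) auto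
  finally show ?thesis
    using LIMSEQ_unique[OF lim1 lim2] by simp
qed

lemma weak_derivative_imp_has_vector_derivative:
  fixes u v :: "real \<Rightarrow> 'a::euclidean_space"
  assumes u: "continuous_on {t0<..} u" and v: "continuous_on {t0<..} v"
    and weak: "weak_derivative t0 u v" and t: "t0 < t"
  shows "(u has_vector_derivative v t) (at t)"
proof -
  define a where "a = (t0 + t) / 2"
  have a: "t0 < a" "a < t" using t by (auto simp: a_def)
  have "((\<lambda>s. integral {a..s} v) has_vector_derivative v t) (at t within {a..t+1})"
    using a by (intro integral_has_vector_derivative continuous_on_subset[OF v]) auto
  moreover have "at t within {a..t+1} = at t" using a by (intro at_within_interior) auto
  ultimately have "((\<lambda>s. u a + integral {a..s} v) has_vector_derivative v t) (at t)"
    by (auto intro!: derivative_eq_intros)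
  then show ?thesis
  proof (rule has_vector_derivative_transform_within_open[OF _ open_greaterThan])
    show "t \<in> {a<..}" using a by simp
    show "u a + integral {a..s} v = u s" if "s \<in> {a<..}" for s
      using weak_derivative_imp_integral[OF u v weak a(1), of s] that by (auto simp: algebra_simps)
  qed
qed

text \<open>Measurability of \<open>v\<close> comes from its local integrability, and only matters on the bounded support
  of the test function.\<close>
lemma weak_derivative_cong_AE:
  assumes "weak_derivative t0 u v" and ae: "AE t in lebesgue. t0 < t \<longrightarrow> v t = w t"
    and w: "continuous_on {t0<..} w" and v: "L1_loc t0 v"
  shows "weak_derivative t0 u w"
proof -
  have w_meas: "(\<lambda>t. indicator {t0<..} t *\<^sub>R w t) \<in> borel_measurable lebesgue"
    using w by (intro measurable_completion) (auto intro: borel_measurable_continuous_on_indicator)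
  show ?thesis
    unfolding weak_derivative_def
  proof (intro allI impI)
    fix \<phi> assume \<phi>: "test_function t0 \<phi>"
    have "continuous_on UNIV \<phi>"
      using \<phi> C1_differentiable_imp_continuous_on unfolding test_function_def by blast
    then have \<phi>_meas: "\<phi> \<in> borel_measurable lebesgue"
      by (intro measurable_completion) (simp add: borel_measurable_continuous_onI)
    have "bounded (closure {t. \<phi> t \<noteq> 0})"
      using \<phi> compact_imp_bounded unfolding test_function_def by blast
    then obtain T where "\<forall>t\<in>closure {t. \<phi> t \<noteq> 0}. norm t \<le> T"
      unfolding bounded_iff by blast
    then have "\<phi> t = 0 \<or> norm t \<le> T" for t
      using closure_subset[of "{t. \<phi> t \<noteq> 0}"] by blast
    then have T: "t \<le> T" if "\<phi> t \<noteq> 0" for t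
      using that by (metis abs_le_D1 real_norm_def)
    have "set_integrable lebesgue {t0..max t0 T} v"
      using v by (simp add: L1_loc_def)
    then have v_meas: "(\<lambda>t. indicator {t0..max t0 T} t *\<^sub>R v t) \<in> borel_measurable lebesgue"
      unfolding set_integrable_def by (rule borel_measurable_integrable)
    have "(\<lambda>t. (indicator {t0<..} t * \<phi> t) *\<^sub>R (indicator {t0..max t0 T} t *\<^sub>R v t)) \<in> borel_measurable lebesgue"
      by (intro borel_measurable_scaleR[OF borel_measurable_times[OF _ \<phi>_meas] v_meas] measurable_completion) auto
    moreover have "(\<lambda>t. (indicator {t0<..} t * \<phi> t) *\<^sub>R (indicator {t0..max t0 T} t *\<^sub>R v t))
        = (\<lambda>t. indicator {t0<..} t *\<^sub>R (\<phi> t *\<^sub>R v t))"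
      using T by (auto simp: fun_eq_iff indicator_def le_max_iff_disj)
    ultimately have meas: "(\<lambda>t. indicator {t0<..} t *\<^sub>R (\<phi> t *\<^sub>R v t)) \<in> borel_measurable lebesgue"
      by simp
    have "(\<lambda>t. \<phi> t *\<^sub>R (indicator {t0<..} t *\<^sub>R w t)) \<in> borel_measurable lebesgue"
      by (rule borel_measurable_scaleR[OF \<phi>_meas w_meas])
    then have meas': "(\<lambda>t. indicator {t0<..} t *\<^sub>R (\<phi> t *\<^sub>R w t)) \<in> borel_measurable lebesgue"
      by (simp add: mult.commute)
    have "AE t in lebesgue. indicator {t0<..} t *\<^sub>R (\<phi> t *\<^sub>R v t) = indicator {t0<..} t *\<^sub>R (\<phi> t *\<^sub>R w t)"
      using ae by eventually_elim (auto simp: indicator_def)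
    then have "(LINT t:{t0<..}|lebesgue. \<phi> t *\<^sub>R v t) = (LINT t:{t0<..}|lebesgue. \<phi> t *\<^sub>R w t)"
      unfolding set_lebesgue_integral_def by (intro integral_cong_AE meas meas')
    then show "(LINT t:{t0<..}|lebesgue. deriv \<phi> t *\<^sub>R u t) = - (LINT t:{t0<..}|lebesgue. \<phi> t *\<^sub>R w t)"
      using assms(1) \<phi> unfolding weak_derivative_def by simp
  qed
qed

section \<open>Convex functions with Lipschitz gradient\<close>

text \<open>The Bregman divergence of \<open>h\<close> with base point \<open>z\<close>: the error at \<open>u\<close> of the first-order expansion
  of \<open>h\<close> at \<open>z\<close>.\<close>
definition bregman :: "('a::euclidean_space \<Rightarrow> real) \<Rightarrow> 'a \<Rightarrow> 'a \<Rightarrow> real" where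
  "bregman h z u = h u - h z - (u - z) \<bullet> grad h z"

lemma has_real_derivative_compose_grad:
  fixes \<gamma> :: "real \<Rightarrow> 'a::euclidean_space"
  assumes "h differentiable (at (\<gamma> t))" and "(\<gamma> has_vector_derivative \<gamma>') (at t)"
  shows "((\<lambda>s. h (\<gamma> s)) has_real_derivative \<gamma>' \<bullet> grad h (\<gamma> t)) (at t)"
proof -
  have "(h has_derivative (\<lambda>k. k \<bullet> grad h (\<gamma> t))) (at (\<gamma> t))"
    using differentiable_imp_GDERIV_grad[OF assms(1)] unfolding gderiv_def .
  from has_derivative_compose[OF assms(2)[unfolded has_vector_derivative_def] this]
  show ?thesis
    by (simp add: has_field_derivative_def mult.commute fun_eq_iff mult_commute_abs)
qed

lemma has_real_derivative_norm_square:
  fixes \<gamma> :: "real \<Rightarrow> 'a::euclidean_space"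
  assumes "(\<gamma> has_vector_derivative \<gamma>') (at t)"
  shows "((\<lambda>s. (norm (\<gamma> s))\<^sup>2) has_real_derivative 2 * (\<gamma> t \<bullet> \<gamma>')) (at t)"
proof -
  have "((\<lambda>s. \<gamma> s \<bullet> \<gamma> s) has_derivative (\<lambda>k. \<gamma> t \<bullet> (k *\<^sub>R \<gamma>') + (k *\<^sub>R \<gamma>') \<bullet> \<gamma> t)) (at t)"
    using assms unfolding has_vector_derivative_def by (intro has_derivative_inner)
  moreover have "(\<lambda>k. \<gamma> t \<bullet> (k *\<^sub>R \<gamma>') + (k *\<^sub>R \<gamma>') \<bullet> \<gamma> t) = (*) (2 * (\<gamma> t \<bullet> \<gamma>'))"
    by (simp add: fun_eq_iff inner_commute)
  ultimately show ?thesis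
    by (simp add: has_field_derivative_def power2_norm_eq_inner)
qed

lemma line_has_vector_derivative: "((\<lambda>s. z + s *\<^sub>R d) has_vector_derivative d) (at s)"
  by (auto intro!: derivative_eq_intros)

lemma bregman_nonneg:
  assumes conv: "convex_on UNIV h" and diff: "\<And>u. h differentiable (at u)"
  shows "0 \<le> bregman h z u"
proof -
  define \<gamma> where "\<gamma> s = z + s *\<^sub>R (u - z)" for s
  have "convex_on UNIV (\<lambda>s. h (\<gamma> s))"
  proof (rule convex_onI)
    fix t r s :: real assume "0 < t" "t < 1"
    moreover have "\<gamma> ((1 - t) *\<^sub>R r + t *\<^sub>R s) = (1 - t) *\<^sub>R \<gamma> r + t *\<^sub>R \<gamma> s"
      by (simp add: \<gamma>_def algebra_simps)
    ultimately show "h (\<gamma> ((1 - t) *\<^sub>R r + t *\<^sub>R s)) \<le> (1 - t) * h (\<gamma> r) + t * h (\<gamma> s)"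
      using convex_onD[OF conv, of t "\<gamma> r" "\<gamma> s"] by simp
  qed auto
  moreover have "((\<lambda>s. h (\<gamma> s)) has_real_derivative (u - z) \<bullet> grad h (\<gamma> 0)) (at 0)"
    unfolding \<gamma>_def by (intro has_real_derivative_compose_grad diff line_has_vector_derivative)
  ultimately have "h (\<gamma> 1) - h (\<gamma> 0) \<ge> ((u - z) \<bullet> grad h (\<gamma> 0)) * (1 - 0)"
    by (intro convex_on_imp_above_tangent[where A = UNIV]) auto
  then show ?thesis by (simp add: bregman_def \<gamma>_def)
qed

text \<open>The descent lemma.\<close>
lemma bregman_le_norm_square:
  assumes diff: "\<And>u. h differentiable (at u)" and lip: "L-lipschitz_on UNIV (grad h)"
  shows "bregman h z u \<le> L / 2 * (norm (u - z))\<^sup>2"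
proof -
  define d where "d = u - z"
  define \<phi> where "\<phi> s = h (z + s *\<^sub>R d) - s * (d \<bullet> grad h z) - L / 2 * s\<^sup>2 * (norm d)\<^sup>2" for s
  have "\<phi> 1 \<le> \<phi> 0"
  proof (rule DERIV_nonpos_imp_nonincreasing[where f = \<phi>])
    fix s :: real assume s: "0 \<le> s" "s \<le> 1"
    have "((\<lambda>s. h (z + s *\<^sub>R d)) has_real_derivative d \<bullet> grad h (z + s *\<^sub>R d)) (at s)"
      by (intro has_real_derivative_compose_grad diff line_has_vector_derivative)
    then have "(\<phi> has_real_derivative d \<bullet> grad h (z + s *\<^sub>R d) - d \<bullet> grad h z - L * s * (norm d)\<^sup>2) (at s)"
      unfolding \<phi>_def by (auto intro!: derivative_eq_intros)
    moreover have "d \<bullet> grad h (z + s *\<^sub>R d) - d \<bullet> grad h z \<le> L * s * (norm d)\<^sup>2"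
    proof -
      have "d \<bullet> grad h (z + s *\<^sub>R d) - d \<bullet> grad h z = d \<bullet> (grad h (z + s *\<^sub>R d) - grad h z)"
        by (simp add: inner_diff_right)
      also have "\<dots> \<le> norm d * norm (grad h (z + s *\<^sub>R d) - grad h z)"
        by (rule norm_cauchy_schwarz)
      also have "\<dots> \<le> norm d * (L * norm (s *\<^sub>R d))"
        using lipschitz_onD[OF lip, of "z + s *\<^sub>R d" z]
        by (intro mult_left_mono) (auto simp: dist_norm)
      finally show ?thesis using s by (simp add: power2_eq_square mult_ac)
    qed
    ultimately show "\<exists>D. (\<phi> has_real_derivative D) (at s) \<and> D \<le> 0" by force
  qed simp
  then show ?thesis by (simp add: \<phi>_def d_def bregman_def)
qed

text \<open>The proof compares the nonnegative value of the divergence at the gradient step \<open>w\<close>, of length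
  \<open>1 / L\<close>, with its value at \<open>u\<close>.\<close>
lemma grad_diff_square_le_bregman:
  assumes conv: "convex_on UNIV h" and diff: "\<And>u. h differentiable (at u)"
    and lip: "L-lipschitz_on UNIV (grad h)" and L: "L > 0"
  shows "(norm (grad h u - grad h z))\<^sup>2 / (2 * L) \<le> bregman h z u"
proof -
  define G where "G = grad h u - grad h z"
  define w where "w = u - (1 / L) *\<^sub>R G"
  have "0 \<le> bregman h z w" by (rule bregman_nonneg[OF conv diff])
  also have "\<dots> = bregman h z u + bregman h u w + (w - u) \<bullet> G"
    by (simp add: bregman_def G_def algebra_simps inner_diff_left inner_diff_right)
  also have "\<dots> \<le> bregman h z u + L / 2 * (norm (w - u))\<^sup>2 + (w - u) \<bullet> G"
    using bregman_le_norm_square[OF diff lip, of u w] by simp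
  also have "\<dots> = bregman h z u - (norm G)\<^sup>2 / (2 * L)"
    using L by (simp add: w_def field_simps power2_eq_square flip: power2_norm_eq_inner)
  finally show ?thesis by (simp add: G_def)
qed

text \<open>A strengthened cocoercivity inequality. The inner product is the symmetrized divergence; one of
  its two summands is bounded below by the gradient difference.\<close>
lemma bregman_add_grad_diff_square_le_inner:
  assumes conv: "convex_on UNIV h" and diff: "\<And>u. h differentiable (at u)"
    and lip: "L-lipschitz_on UNIV (grad h)" and L: "L > 0"
  shows "bregman h z u + (norm (grad h u - grad h z))\<^sup>2 / (2 * L) \<le> (u - z) \<bullet> (grad h u - grad h z)"
proof -
  have "bregman h z u + bregman h u z = (u - z) \<bullet> (grad h u - grad h z)"
    by (simp add: bregman_def algebra_simps inner_diff_left inner_diff_right)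
  then show ?thesis
    using grad_diff_square_le_bregman[OF conv diff lip L, of z u] by (simp add: norm_minus_commute)
qed

section \<open>The primal-dual gap at a saddle point\<close>

lemma saddle_point_stationary:
  assumes f: "\<And>u. f differentiable (at u)" and g: "\<And>v. g differentiable (at v)"
    and saddle: "(us, vs) \<in> saddle_points f g K"
  shows "adjoint ((*v) K) vs = - grad f us" and "K *v us = grad g vs"
proof -
  have le: "lagrangian f g K us v \<le> lagrangian f g K us vs" "lagrangian f g K us vs \<le> lagrangian f g K u vs"
    for u v using saddle by (auto simp: saddle_points_def)
  have "((\<lambda>u. lagrangian f g K u vs) has_derivative (\<lambda>k. k \<bullet> (grad f us + adjoint ((*v) K) vs))) (at us)"
  proof -
    have "(K *v k) \<bullet> vs = k \<bullet> adjoint ((*v) K) vs" for k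
      using adjoint_works[of "(*v) K" k vs] by (simp add: matrix_vector_mul_linear)
    then show ?thesis
      using differentiable_imp_GDERIV_grad[OF f, of us] unfolding gderiv_def lagrangian_def
      by (auto intro!: derivative_eq_intros simp: inner_add_right)
  qed
  then have "(\<lambda>k. k \<bullet> (grad f us + adjoint ((*v) K) vs)) = (\<lambda>k. 0)"
    by (rule differential_zero_maxmin[OF _ open_UNIV, rotated]) (use le in auto)
  then have "grad f us + adjoint ((*v) K) vs = 0" by (metis inner_eq_zero_iff)
  then show "adjoint ((*v) K) vs = - grad f us" by (simp add: eq_neg_iff_add_eq_0 add.commute)
  have "((\<lambda>v. lagrangian f g K us v) has_derivative (\<lambda>k. k \<bullet> (K *v us - grad g vs))) (at vs)"
    using differentiable_imp_GDERIV_grad[OF g, of vs] unfolding gderiv_def lagrangian_def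
    by (auto intro!: derivative_eq_intros simp: inner_diff_right inner_commute)
  then have "(\<lambda>k. k \<bullet> (K *v us - grad g vs)) = (\<lambda>k. 0)"
    by (rule differential_zero_maxmin[OF _ open_UNIV, rotated]) (use le in auto)
  then have "K *v us - grad g vs = 0" by (metis inner_eq_zero_iff)
  then show "K *v us = grad g vs" by simp
qed

text \<open>By stationarity, the bilinear terms of the gap are exactly the linear terms of the two
  Bregman divergences.\<close>
lemma lagrangian_gap_eq_bregman:
  assumes "\<And>u. f differentiable (at u)" and "\<And>v. g differentiable (at v)"
    and "(us, vs) \<in> saddle_points f g K"
  shows "lagrangian f g K u vs - lagrangian f g K us v = bregman f us u + bregman g vs v"
proof -
  have "(K *v (u - us)) \<bullet> vs = (u - us) \<bullet> adjoint ((*v) K) vs"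
    using adjoint_works[of "(*v) K" "u - us" vs] by (simp add: matrix_vector_mul_linear)
  moreover have "(K *v us) \<bullet> v - (K *v us) \<bullet> vs = (v - vs) \<bullet> (K *v us)"
    by (simp add: inner_diff_left inner_diff_right inner_commute)
  ultimately show ?thesis
    using saddle_point_stationary[OF assms]
    by (simp add: lagrangian_def bregman_def matrix_vector_mult_diff_distrib inner_diff_left)
qed

section \<open>Integrals and decay rates on a half-line\<close>

text \<open>The integrated form of the differential inequality \<open>E' + W \<le> R\<close>.\<close>
lemma energy_dissipation_inequality:
  fixes E R W :: "real \<Rightarrow> real"
  assumes E: "continuous_on {a..} E" and R: "continuous_on {a..} R" and W: "continuous_on {a..} W"
    and deriv: "\<And>t. a < t \<Longrightarrow> \<exists>D. (E has_real_derivative D) (at t) \<and> D \<le> R t - W t"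
    and T: "a \<le> T"
  shows "E T + integral {a..T} W \<le> E a + integral {a..T} R"
proof -
  have sub: "continuous_on {a..T} E" "continuous_on {a..T} R" "continuous_on {a..T} W"
    using E R W by (auto elim: continuous_on_subset)
  have "E T + integral {a..T} (\<lambda>s. W s - R s) \<le> E a + integral {a..a} (\<lambda>s. W s - R s)"
  proof (rule DERIV_nonpos_imp_decreasing_open[OF T])
    fix t assume t: "a < t" "t < T"
    then obtain D where D: "(E has_real_derivative D) (at t)" "D \<le> R t - W t"
      using deriv by blast
    have "((\<lambda>s. integral {a..s} (\<lambda>s. W s - R s)) has_real_derivative W t - R t) (at t within {a..T})"
      using t sub by (intro integral_has_real_derivative continuous_intros) auto
    moreover have "at t within {a..T} = at t" using t by (intro at_within_interior) auto
    ultimately have "((\<lambda>s. E s + integral {a..s} (\<lambda>s. W s - R s)) has_real_derivative D + (W t - R t)) (at t)"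
      using D by (intro DERIV_add) auto
    then show "\<exists>y. ((\<lambda>s. E s + integral {a..s} (\<lambda>s. W s - R s)) has_real_derivative y) (at t) \<and> y \<le> 0"
      using D by force
  next
    show "continuous_on {a..T} (\<lambda>s. E s + integral {a..s} (\<lambda>s. W s - R s))"
      using sub by (intro continuous_intros indefinite_integral_continuous_1 integrable_continuous_real)
  qed
  moreover have "integral {a..T} (\<lambda>s. W s - R s) = integral {a..T} W - integral {a..T} R"
    using sub by (intro Henstock_Kurzweil_Integration.integral_diff integrable_continuous_real)
  ultimately show ?thesis by simp
qed

lemma set_integrable_atLeast_nonneg:
  fixes w :: "real \<Rightarrow> real"
  assumes w: "continuous_on {a..} w" and nonneg: "\<And>t. a \<le> t \<Longrightarrow> 0 \<le> w t"
    and bound: "\<And>T. a \<le> T \<Longrightarrow> integral {a..T} w \<le> B"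
  shows "set_integrable lebesgue {a..} w"
proof (rule nonnegative_absolutely_integrable_1)
  let ?w = "\<lambda>k t. if t \<in> {a..a + real k} then w t else 0"
  have int: "w integrable_on {a..T}" for T
    by (intro integrable_continuous_real continuous_on_subset[OF w]) auto
  have eq: "integral {a..} (?w k) = integral {a..a + real k} w" for k
    by (subst integral_restrict_Int) (simp add: Int_absorb2)
  have "w integrable_on {a..} \<and> (\<lambda>k. integral {a..} (?w k)) \<longlonglongrightarrow> integral {a..} w"
  proof (rule monotone_convergence_increasing)
    show "?w k integrable_on {a..}" for k
      using int by (subst integrable_restrict_Int) (simp add: Int_absorb2)
    show "?w k t \<le> ?w (Suc k) t" if "t \<in> {a..}" for k t
      using that nonneg by auto
    show "(\<lambda>k. ?w k t) \<longlonglongrightarrow> w t" if "t \<in> {a..}" for t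
    proof (rule tendsto_eventually)
      obtain N where "t - a \<le> real N" using real_arch_simple by blast
      then show "\<forall>\<^sub>F k in sequentially. ?w k t = w t"
        using that by (intro eventually_sequentiallyI[of N]) auto
    qed
    have "norm (integral {a..} (?w k)) \<le> B" for k
      unfolding eq using bound[of "a + real k"] integral_nonneg[OF int, of "a + real k"] nonneg
      by simp
    then show "bounded (range (\<lambda>k. integral {a..} (?w k)))"
      unfolding bounded_iff by auto
  qed
  then show "w integrable_on {a..}" by simp
qed (use nonneg in auto)

lemma integral_le_atLeast:
  fixes h :: "real \<Rightarrow> real"
  assumes h: "set_integrable lebesgue {a..} h" and nonneg: "\<And>t. a \<le> t \<Longrightarrow> 0 \<le> h t"
  shows "integral {a..T} h \<le> integral {a..} h"
proof (rule integral_subset_le)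
  show "h integrable_on {a..}" using h set_lebesgue_integral_eq_integral(1) by blast
  have "set_integrable lebesgue {a..T} h" by (rule set_integrable_subset[OF h]) auto
  then show "h integrable_on {a..T}" using set_lebesgue_integral_eq_integral(1) by blast
qed (use nonneg in auto)

text \<open>For integrable \<open>h\<close> the mean with weight \<open>s\<^sup>2 / t\<^sup>2 \<le> 1\<close> vanishes: on the tail, where \<open>h\<close> has small
  integral, the weight is at most \<open>1\<close>, and the remaining part is a constant divided by \<open>t\<^sup>2\<close>.\<close>
lemma integral_square_weight_tendsto_0:
  fixes h :: "real \<Rightarrow> real"
  assumes a: "0 \<le> a" and h: "continuous_on {a..} h" and nonneg: "\<And>t. a \<le> t \<Longrightarrow> 0 \<le> h t"
    and bound: "\<And>T. a \<le> T \<Longrightarrow> integral {a..T} h \<le> B"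
  shows "((\<lambda>t. integral {a..t} (\<lambda>s. s\<^sup>2 * h s) / t\<^sup>2) \<longlongrightarrow> 0) at_top"
proof (rule tendstoI)
  fix e :: real assume e: "0 < e"
  have int: "k integrable_on {r..T}" if "a \<le> r" "continuous_on {a..} k" for k :: "real \<Rightarrow> real" and r T
    using that by (intro integrable_continuous_real continuous_on_subset[OF that(2)]) auto
  have k: "continuous_on {a..} (\<lambda>s. s\<^sup>2 * h s)" by (intro continuous_intros h)
  define S where "S = (SUP T\<in>{a..}. integral {a..T} h)"
  have bdd: "bdd_above ((\<lambda>T. integral {a..T} h) ` {a..})"
    using bound by (auto intro!: bdd_aboveI)
  have "S - e / 2 < S" using e by simp
  then obtain T where T: "a \<le> T" "S - e / 2 < integral {a..T} h"
    unfolding S_def using less_cSUP_iff[OF _ bdd] by auto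
  define C where "C = integral {a..T} (\<lambda>s. s\<^sup>2 * h s)"
  have "((\<lambda>t. C / t\<^sup>2) \<longlongrightarrow> 0) at_top"
    by (intro tendsto_divide_0[OF tendsto_const] filterlim_at_top_imp_at_infinity
        filterlim_pow_at_top filterlim_ident) auto
  then have "\<forall>\<^sub>F t in at_top. C / t\<^sup>2 < e / 2" using e by (intro order_tendstoD) auto
  then show "\<forall>\<^sub>F t in at_top. dist (integral {a..t} (\<lambda>s. s\<^sup>2 * h s) / t\<^sup>2) 0 < e"
    using eventually_ge_at_top[of T] eventually_gt_at_top[of 0]
  proof eventually_elim
    case (elim t)
    have "integral {a..T} h + integral {T..t} h = integral {a..t} h"
      using T elim by (intro Henstock_Kurzweil_Integration.integral_combine int h) auto
    also have "\<dots> \<le> S"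
      unfolding S_def using T elim by (intro cSUP_upper bdd) auto
    finally have tail: "integral {T..t} h \<le> e / 2" using T by simp
    have "integral {T..t} (\<lambda>s. s\<^sup>2 * h s) \<le> integral {T..t} (\<lambda>s. t\<^sup>2 * h s)"
      using T a nonneg
      by (intro integral_le int k continuous_intros h mult_right_mono power_mono) auto
    also have "\<dots> = t\<^sup>2 * integral {T..t} h" by simp
    also have "\<dots> \<le> t\<^sup>2 * (e / 2)" by (intro mult_left_mono tail) auto
    finally have "integral {a..t} (\<lambda>s. s\<^sup>2 * h s) \<le> C + t\<^sup>2 * (e / 2)"
      using Henstock_Kurzweil_Integration.integral_combine[OF T(1) elim(2) int[OF order_refl k]]
      by (simp add: C_def)
    then have "integral {a..t} (\<lambda>s. s\<^sup>2 * h s) / t\<^sup>2 \<le> (C + t\<^sup>2 * (e / 2)) / t\<^sup>2"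
      by (intro divide_right_mono) auto
    also have "\<dots> = C / t\<^sup>2 + e / 2" using elim by (simp add: field_simps)
    also have "\<dots> < e" using elim by linarith
    finally have "integral {a..t} (\<lambda>s. s\<^sup>2 * h s) / t\<^sup>2 < e" .
    moreover have "0 \<le> integral {a..t} (\<lambda>s. s\<^sup>2 * h s)"
      using nonneg by (intro integral_nonneg int k) auto
    ultimately show ?case by (simp add: dist_real_def)
  qed
qed

lemma bigo_of_weighted_square:
  fixes q :: "real \<Rightarrow> real"
  assumes nonneg: "\<And>t. 0 \<le> q t" and "\<forall>\<^sub>F t in at_top. t powr r * (q t)\<^sup>2 \<le> C"
  shows "q \<in> O[at_top](\<lambda>t. t powr (- (r / 2)))"
proof (rule bigoI)
  show "\<forall>\<^sub>F t in at_top. norm (q t) \<le> sqrt C * norm (t powr (- (r / 2)))"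
    using assms(2) eventually_gt_at_top[of 0]
  proof eventually_elim
    case (elim t)
    have "(t powr (r / 2) * q t)\<^sup>2 = t powr r * (q t)\<^sup>2"
      by (simp add: power_mult_distrib power2_eq_square flip: powr_add)
    then have "t powr (r / 2) * q t \<le> sqrt C" using elim by (intro real_le_rsqrt) simp
    then show ?case using nonneg[of t] elim by (simp add: powr_minus field_simps)
  qed
qed

lemma smallo_of_weighted_square:
  fixes q :: "real \<Rightarrow> real"
  assumes nonneg: "\<And>t. 0 \<le> q t" and lim: "((\<lambda>t. t powr r * (q t)\<^sup>2) \<longlongrightarrow> 0) at_top"
  shows "q \<in> o[at_top](\<lambda>t. t powr (- (r / 2)))"
proof (rule smalloI_tendsto)
  have "((\<lambda>t. sqrt (t powr r * (q t)\<^sup>2)) \<longlongrightarrow> 0) at_top"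
    using tendsto_real_sqrt[OF lim] by simp
  moreover have "\<forall>\<^sub>F t in at_top. sqrt (t powr r * (q t)\<^sup>2) = q t / t powr (- (r / 2))"
    using eventually_gt_at_top[of 0]
  proof eventually_elim
    case (elim t)
    have "t powr r * (q t)\<^sup>2 = (t powr (r / 2) * q t)\<^sup>2"
      by (simp add: power_mult_distrib power2_eq_square flip: powr_add)
    then have "sqrt (t powr r * (q t)\<^sup>2) = t powr (r / 2) * q t"
      using nonneg[of t] by (simp only: real_sqrt_abs) simp
    then show ?case using elim by (simp add: powr_minus field_simps)
  qed
  ultimately show "((\<lambda>t. q t / t powr (- (r / 2))) \<longlongrightarrow> 0) at_top"
    by (rule Lim_transform_eventually)
  show "\<forall>\<^sub>F t in at_top. t powr (- (r / 2)) \<noteq> 0"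
    using eventually_gt_at_top[of 0] by eventually_elim simp
qed

section \<open>The Lyapunov function of one variable\<close>

text \<open>The part of the Lyapunov function that belongs to one of the two variables of the system; it is
  used for \<open>h = f\<close> with \<open>x\<close>, and for \<open>h = g\<close> with \<open>y\<close>. The point \<open>z\<close> is the corresponding
  component of the saddle point. With \<open>m = \<theta> * (\<alpha> - 1) - 1\<close>, the coefficient
  \<open>m + \<theta> * c * t powr (1 - p)\<close> of the last term is chosen such that the terms
  \<open>(x t - z) \<bullet> x' t\<close> cancel in the derivative.\<close>
definition block_energy ::
  "real \<Rightarrow> real \<Rightarrow> real \<Rightarrow> real \<Rightarrow> real \<Rightarrow> (real \<Rightarrow> real) \<Rightarrow> ('a::euclidean_space \<Rightarrow> real) \<Rightarrow>
   (real \<Rightarrow> 'a) \<Rightarrow> (real \<Rightarrow> 'a) \<Rightarrow> 'a \<Rightarrow> real \<Rightarrow> real" where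
  "block_energy \<alpha> \<beta> c p \<theta> eps h x x' z t =
     \<theta>\<^sup>2 * t powr (\<beta> + 2) * (bregman h z (x t) + eps t / 2 * (norm (x t))\<^sup>2)
     + (norm (x t - z + (\<theta> * t) *\<^sub>R x' t))\<^sup>2 / 2
     + (\<theta> * (\<alpha> - 1) - 1 + \<theta> * c * t powr (1 - p)) / 2 * (norm (x t - z))\<^sup>2"

text \<open>A lower bound for the rate at which \<open>block_energy\<close> is dissipated. For \<open>\<alpha> > 1\<close>,
  \<open>\<beta> \<ge> 0\<close> and \<open>L > 0\<close>, all three coefficients are positive if
  \<open>1 / (\<alpha> - 1) < \<theta> < 1 / (\<beta> + 2)\<close>.\<close>
definition block_dissipation ::
  "real \<Rightarrow> real \<Rightarrow> real \<Rightarrow> real \<Rightarrow> ('a::euclidean_space \<Rightarrow> real) \<Rightarrow>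
   (real \<Rightarrow> 'a) \<Rightarrow> (real \<Rightarrow> 'a) \<Rightarrow> 'a \<Rightarrow> real \<Rightarrow> real" where
  "block_dissipation \<alpha> \<beta> \<theta> L h x x' z t =
     (\<theta> * (\<alpha> - 1) - 1) * \<theta> * t * (norm (x' t))\<^sup>2
     + \<theta> * (1 - \<theta> * (\<beta> + 2)) * t powr (\<beta> + 1) * bregman h z (x t)
     + \<theta> / (2 * L) * t powr (\<beta> + 1) * (norm (grad h (x t) - grad h z))\<^sup>2"

text \<open>The vector \<open>q\<close> stands for the coupling with the other variable, up to its value at the saddle
  point. Apart from the coupling and from the regularization term, the energy decreases at least at
  the rate \<open>block_dissipation\<close>.\<close>
lemma block_energy_derivative:
  fixes x x' :: "real \<Rightarrow> 'a::euclidean_space"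
  assumes conv: "convex_on UNIV h" and diff: "\<And>u. h differentiable (at u)"
    and lip: "L-lipschitz_on UNIV (grad h)" and L: "L > 0"
    and par: "c \<ge> 0" "p > 1" "\<theta> > 0" "\<theta> * (\<beta> + 2) \<le> 1" and t: "t > 0"
    and eps: "(eps has_real_derivative e') (at t)" "eps t \<ge> 0" "e' \<le> 0"
    and x: "(x has_vector_derivative x' t) (at t)" and x': "(x' has_vector_derivative x'') (at t)"
    and eq: "x'' = - (\<alpha> / t + c / t powr p) *\<^sub>R x' t
                - (t powr \<beta>) *\<^sub>R (grad h (x t) - grad h z + q + eps t *\<^sub>R x t)"
  obtains D where "(block_energy \<alpha> \<beta> c p \<theta> eps h x x' z has_real_derivative D) (at t)"
    and "D \<le> \<theta> * t powr (\<beta> + 1) * eps t / 2 * (norm z)\<^sup>2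
           - block_dissipation \<alpha> \<beta> \<theta> L h x x' z t
           - \<theta> * t powr (\<beta> + 1) * ((x t - z + (\<theta> * t) *\<^sub>R x' t) \<bullet> q)"
proof -
  define Q where "Q = t powr (\<beta> + 1)"
  define C where "C = t powr (1 - p)"
  define m where "m = \<theta> * (\<alpha> - 1) - 1"
  define G where "G = grad h (x t) - grad h z"
  define u where "u = x t - z + (\<theta> * t) *\<^sub>R x' t"
  define B where "B = bregman h z (x t)"
  have Q: "t powr (\<beta> + 2) = t * Q" "t * t powr \<beta> = Q" "Q > 0"
  proof -
    have "t powr (\<beta> + 2) = t powr (1 + (\<beta> + 1))" by (simp add: algebra_simps)
    also have "\<dots> = t * Q" using t unfolding powr_add[of t 1] Q_def by simp
    finally show "t powr (\<beta> + 2) = t * Q" .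
  qed (use t in \<open>simp_all add: Q_def powr_add\<close>)
  have C: "t / t powr p = C" "C > 0"
    using t by (simp_all add: C_def powr_diff)
  have dB: "((\<lambda>t. bregman h z (x t)) has_real_derivative x' t \<bullet> G) (at t)"
  proof -
    have "((\<lambda>t. x t - z) has_vector_derivative x' t) (at t)"
      using x by (auto intro!: derivative_eq_intros)
    from bounded_linear.has_vector_derivative[OF bounded_linear_inner_left this, of "grad h z"]
    have "((\<lambda>t. (x t - z) \<bullet> grad h z) has_real_derivative x' t \<bullet> grad h z) (at t)"
      by (simp add: has_real_derivative_iff_has_vector_derivative)
    moreover have "((\<lambda>t. h (x t)) has_real_derivative x' t \<bullet> grad h (x t)) (at t)"
      by (intro has_real_derivative_compose_grad diff x)
    ultimately show ?thesis unfolding bregman_def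
      by (auto intro!: derivative_eq_intros simp: G_def inner_diff_right)
  qed
  have dx: "((\<lambda>t. (norm (x t))\<^sup>2) has_real_derivative 2 * (x t \<bullet> x' t)) (at t)"
    by (rule has_real_derivative_norm_square[OF x])
  have dxz: "((\<lambda>t. (norm (x t - z))\<^sup>2) has_real_derivative 2 * ((x t - z) \<bullet> x' t)) (at t)"
    using x by (intro has_real_derivative_norm_square) (auto intro!: derivative_eq_intros)
  have u': "((\<lambda>t. x t - z + (\<theta> * t) *\<^sub>R x' t) has_vector_derivative
      - ((m + \<theta> * c * C) *\<^sub>R x' t) - (\<theta> * Q) *\<^sub>R (G + q + eps t *\<^sub>R x t)) (at t)"
  proof -
    have "((\<lambda>t. x t - z + (\<theta> * t) *\<^sub>R x' t) has_vector_derivative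
        x' t + ((\<theta> * t) *\<^sub>R x'' + \<theta> *\<^sub>R x' t)) (at t)"
      using x x' by (auto intro!: derivative_eq_intros)
    moreover have "(\<theta> * t) *\<^sub>R x'' = - (\<theta> * (\<alpha> + c * C)) *\<^sub>R x' t
        - (\<theta> * Q) *\<^sub>R (G + q + eps t *\<^sub>R x t)"
    proof -
      have "t * (\<alpha> / t + c / t powr p) = \<alpha> + c * C"
        using t by (simp add: C(1)[symmetric] distrib_left)
      then show ?thesis
        unfolding eq G_def by (simp only: Q scaleR_diff_right scaleR_scaleR mult_minus_right mult.assoc)
    qed
    ultimately show ?thesis
      by (simp add: m_def algebra_simps)
  qed
  have du: "((\<lambda>t. (norm (x t - z + (\<theta> * t) *\<^sub>R x' t))\<^sup>2) has_real_derivative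
      2 * (u \<bullet> (- ((m + \<theta> * c * C) *\<^sub>R x' t) - (\<theta> * Q) *\<^sub>R (G + q + eps t *\<^sub>R x t)))) (at t)"
    unfolding u_def by (rule has_real_derivative_norm_square[OF u'])
  have dQ: "((\<lambda>t. t powr (\<beta> + 2)) has_real_derivative (\<beta> + 2) * Q) (at t)"
    using t has_real_derivative_powr[of t "\<beta> + 2"] by (simp add: Q_def add.commute)
  have dC: "((\<lambda>t. t powr (1 - p)) has_real_derivative (1 - p) * t powr (- p)) (at t)"
    using t has_real_derivative_powr[of t "1 - p"] by simp
  \<comment> \<open>The derivative as the product rule gives it.\<close>
  define D where "D = \<theta>\<^sup>2 * ((\<beta> + 2) * Q) * (B + eps t / 2 * (norm (x t))\<^sup>2)
      + \<theta>\<^sup>2 * (t * Q) * (x' t \<bullet> G + (e' / 2 * (norm (x t))\<^sup>2 + eps t * (x t \<bullet> x' t)))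
      + u \<bullet> (- ((m + \<theta> * c * C) *\<^sub>R x' t) - (\<theta> * Q) *\<^sub>R (G + q + eps t *\<^sub>R x t))
      + (\<theta> * c * ((1 - p) * t powr (- p)) / 2 * (norm (x t - z))\<^sup>2
         + (m + \<theta> * c * C) * ((x t - z) \<bullet> x' t))"
  have "(block_energy \<alpha> \<beta> c p \<theta> eps h x x' z has_real_derivative D) (at t)"
  proof -
    show ?thesis
      unfolding block_energy_def[abs_def]
      by (rule DERIV_cong, (rule DERIV_add DERIV_mult' DERIV_cdivide DERIV_const dQ dC dB dx eps(1) du dxz)+)
         (simp only: D_def B_def[symmetric] C_def[symmetric] m_def[symmetric] Q(1),
          simp add: field_simps)
  qed
  moreover have "D \<le> \<theta> * t powr (\<beta> + 1) * eps t / 2 * (norm z)\<^sup>2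
           - block_dissipation \<alpha> \<beta> \<theta> L h x x' z t
           - \<theta> * t powr (\<beta> + 1) * ((x t - z + (\<theta> * t) *\<^sub>R x' t) \<bullet> q)"
  proof -
    \<comment> \<open>The inner products of \<open>x' t\<close> with \<open>G\<close>, with \<open>x t\<close> and with \<open>x t - z\<close> cancel.\<close>
    have D_eq: "D = \<theta> * Q * ((\<theta> * (\<beta> + 2)) * B + \<theta> * (\<beta> + 2) * (eps t / 2 * (norm (x t))\<^sup>2)
          - (x t - z) \<bullet> G - eps t * ((x t - z) \<bullet> x t) - u \<bullet> q)
        + \<theta>\<^sup>2 * (t * Q) * (e' / 2 * (norm (x t))\<^sup>2)
        - (m + \<theta> * c * C) * \<theta> * t * (norm (x' t))\<^sup>2
        + \<theta> * c * ((1 - p) * t powr (- p)) / 2 * (norm (x t - z))\<^sup>2"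
      unfolding D_def u_def
      by (simp add: inner_add_left inner_add_right inner_diff_left inner_diff_right
           dot_square_norm inner_commute field_simps power2_eq_square)
    have "B + (norm G)\<^sup>2 / (2 * L) \<le> (x t - z) \<bullet> G"
      unfolding B_def G_def by (rule bregman_add_grad_diff_square_le_inner[OF conv diff lip L])
    moreover have "eps t * ((x t - z) \<bullet> x t) \<ge> eps t / 2 * (norm (x t))\<^sup>2 - eps t / 2 * (norm z)\<^sup>2"
    proof -
      have "(norm (x t))\<^sup>2 - (norm z)\<^sup>2 \<le> 2 * ((x t - z) \<bullet> x t)"
        using zero_le_power2[of "norm (x t - z)"]
        by (simp add: power2_norm_eq_inner inner_diff_left inner_diff_right inner_commute)
      from mult_left_mono[OF this, of "eps t / 2"] eps(2) show ?thesis by (simp add: algebra_simps)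
    qed
    moreover have "\<theta> * (\<beta> + 2) * (eps t / 2 * (norm (x t))\<^sup>2) \<le> eps t / 2 * (norm (x t))\<^sup>2"
      using par(4) mult_right_mono[of "\<theta> * (\<beta> + 2)" 1 "eps t / 2 * (norm (x t))\<^sup>2"] eps(2) by simp
    moreover have "(1 - \<theta> * (\<beta> + 2)) * B = B - (\<theta> * (\<beta> + 2)) * B"
      by (simp add: left_diff_distrib)
    ultimately have "(\<theta> * (\<beta> + 2)) * B + \<theta> * (\<beta> + 2) * (eps t / 2 * (norm (x t))\<^sup>2)
          - (x t - z) \<bullet> G - eps t * ((x t - z) \<bullet> x t) - u \<bullet> q
        \<le> eps t / 2 * (norm z)\<^sup>2 - (1 - \<theta> * (\<beta> + 2)) * B - (norm G)\<^sup>2 / (2 * L) - u \<bullet> q"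
      by linarith
    then have "\<theta> * Q * ((\<theta> * (\<beta> + 2)) * B + \<theta> * (\<beta> + 2) * (eps t / 2 * (norm (x t))\<^sup>2)
          - (x t - z) \<bullet> G - eps t * ((x t - z) \<bullet> x t) - u \<bullet> q)
        \<le> \<theta> * Q * (eps t / 2 * (norm z)\<^sup>2 - (1 - \<theta> * (\<beta> + 2)) * B - (norm G)\<^sup>2 / (2 * L) - u \<bullet> q)"
      using par Q(3) by (intro mult_left_mono) auto
    moreover have "\<theta>\<^sup>2 * (t * Q) * (e' / 2 * (norm (x t))\<^sup>2) \<le> 0"
      using t Q(3) eps(3) by (intro mult_nonneg_nonpos mult_nonpos_nonneg) auto
    moreover have "m * \<theta> * t * (norm (x' t))\<^sup>2 \<le> (m + \<theta> * c * C) * \<theta> * t * (norm (x' t))\<^sup>2"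
      using par t C(2) by (intro mult_right_mono) auto
    moreover have "\<theta> * c * ((1 - p) * t powr (- p)) / 2 * (norm (x t - z))\<^sup>2 \<le> 0"
      using par by (intro mult_nonpos_nonneg divide_nonpos_pos mult_nonneg_nonpos) auto
    moreover have "\<theta> * t powr (\<beta> + 1) * eps t / 2 * (norm z)\<^sup>2
           - block_dissipation \<alpha> \<beta> \<theta> L h x x' z t
           - \<theta> * t powr (\<beta> + 1) * ((x t - z + (\<theta> * t) *\<^sub>R x' t) \<bullet> q)
        = \<theta> * Q * (eps t / 2 * (norm z)\<^sup>2 - (1 - \<theta> * (\<beta> + 2)) * B - (norm G)\<^sup>2 / (2 * L) - u \<bullet> q)
          - m * \<theta> * t * (norm (x' t))\<^sup>2"
      unfolding block_dissipation_def m_def[symmetric] Q_def[symmetric] u_def[symmetric] G_def[symmetric] B_def[symmetric]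
      by (simp add: algebra_simps)
    ultimately show ?thesis unfolding D_eq by linarith
  qed
  ultimately show thesis by (rule that)
qed

text \<open>The energy dominates, up to a constant independent of time, every quantity whose rate is to be
  estimated. The velocity is recovered from the anchored vector
  \<open>x t - z + (\<theta> * t) *\<^sub>R x' t\<close> and the distance to \<open>z\<close>.\<close>

lemma block_energy_controls:
  assumes conv: "convex_on UNIV h" and diff: "\<And>u. h differentiable (at u)"
    and lip: "L-lipschitz_on UNIV (grad h)" and L: "L > 0"
    and par: "c \<ge> 0" "\<theta> > 0" "\<theta> * (\<alpha> - 1) > 1"
  shows "\<exists>C>0. \<forall>t>0. eps t \<ge> 0 \<longrightarrow>
      t powr (\<beta> + 2) * bregman h z (x t) \<le> C * block_energy \<alpha> \<beta> c p \<theta> eps h x x' z t \<and>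
      (norm (x t - z))\<^sup>2 \<le> C * block_energy \<alpha> \<beta> c p \<theta> eps h x x' z t \<and>
      t\<^sup>2 * (norm (x' t))\<^sup>2 \<le> C * block_energy \<alpha> \<beta> c p \<theta> eps h x x' z t \<and>
      t powr (\<beta> + 2) * (norm (grad h (x t) - grad h z))\<^sup>2 \<le> C * block_energy \<alpha> \<beta> c p \<theta> eps h x x' z t"
proof -
  define m where "m = \<theta> * (\<alpha> - 1) - 1"
  have m: "m > 0" using par by (simp add: m_def)
  define C where "C = 1 / \<theta>\<^sup>2 + 2 * L / \<theta>\<^sup>2 + 2 / m + (4 + 4 / m) / \<theta>\<^sup>2"
  have C: "1 / \<theta>\<^sup>2 \<le> C" "2 * L / \<theta>\<^sup>2 \<le> C" "2 / m \<le> C" "(4 + 4 / m) / \<theta>\<^sup>2 \<le> C" "C > 0"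
  proof -
    have "1 / \<theta>\<^sup>2 > 0" "2 * L / \<theta>\<^sup>2 > 0" "2 / m > 0" "(4 + 4 / m) / \<theta>\<^sup>2 > 0"
      using par L m by (auto intro!: divide_pos_pos add_pos_pos)
    then show "1 / \<theta>\<^sup>2 \<le> C" "2 * L / \<theta>\<^sup>2 \<le> C" "2 / m \<le> C" "(4 + 4 / m) / \<theta>\<^sup>2 \<le> C" "C > 0"
      unfolding C_def by linarith+
  qed
  show ?thesis
  proof (intro exI[of _ C] conjI[OF C(5)] allI impI)
    fix t :: real assume t: "t > 0" "eps t \<ge> 0"
    define E where "E = block_energy \<alpha> \<beta> c p \<theta> eps h x x' z t"
    define B where "B = bregman h z (x t)"
    define G where "G = grad h (x t) - grad h z"
    define u where "u = x t - z + (\<theta> * t) *\<^sub>R x' t"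
    have B: "0 \<le> B" unfolding B_def by (rule bregman_nonneg[OF conv diff])
    have G: "(norm G)\<^sup>2 \<le> 2 * L * B"
      using grad_diff_square_le_bregman[OF conv diff lip L, of "x t" z] L
      by (simp add: B_def G_def field_simps)
    have E_eq: "E = \<theta>\<^sup>2 * (t powr (\<beta> + 2) * B) + \<theta>\<^sup>2 * t powr (\<beta> + 2) * (eps t / 2 * (norm (x t))\<^sup>2)
        + (norm u)\<^sup>2 / 2 + m / 2 * (norm (x t - z))\<^sup>2 + \<theta> * c * t powr (1 - p) / 2 * (norm (x t - z))\<^sup>2"
      unfolding E_def block_energy_def B_def u_def m_def[symmetric] by (simp add: algebra_simps add_divide_distrib)
    have "0 \<le> \<theta>\<^sup>2 * (t powr (\<beta> + 2) * B)" "0 \<le> \<theta>\<^sup>2 * t powr (\<beta> + 2) * (eps t / 2 * (norm (x t))\<^sup>2)"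
      "0 \<le> (norm u)\<^sup>2 / 2" "0 \<le> m / 2 * (norm (x t - z))\<^sup>2"
      "0 \<le> \<theta> * c * t powr (1 - p) / 2 * (norm (x t - z))\<^sup>2"
      using B t m par by auto
    then have E: "\<theta>\<^sup>2 * (t powr (\<beta> + 2) * B) \<le> E" "(norm u)\<^sup>2 / 2 \<le> E"
      "m / 2 * (norm (x t - z))\<^sup>2 \<le> E" "0 \<le> E"
      unfolding E_eq by linarith+
    have le_C: "K * E \<le> C * E" if "K \<le> C" for K using that E(4) by (rule mult_right_mono)
    have xz: "(norm (x t - z))\<^sup>2 \<le> 2 / m * E"
      using E(3) m by (simp add: field_simps)
    have b1: "t powr (\<beta> + 2) * B \<le> 1 / \<theta>\<^sup>2 * E"
      using E(1) par by (simp add: field_simps)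
    moreover have b2: "t powr (\<beta> + 2) * (norm G)\<^sup>2 \<le> 2 * L / \<theta>\<^sup>2 * E"
    proof -
      have "t powr (\<beta> + 2) * (norm G)\<^sup>2 \<le> 2 * L * (t powr (\<beta> + 2) * B)"
        using mult_left_mono[OF G, of "t powr (\<beta> + 2)"] by (simp add: mult_ac)
      also have "\<dots> \<le> 2 * L * (1 / \<theta>\<^sup>2 * E)" using b1 L by (intro mult_left_mono) auto
      finally show ?thesis by simp
    qed
    moreover have "t\<^sup>2 * (norm (x' t))\<^sup>2 \<le> (4 + 4 / m) / \<theta>\<^sup>2 * E"
    proof -
      have "\<theta> * t * norm (x' t) = norm (u - (x t - z))"
        using par t by (simp add: u_def)
      also have "\<dots> \<le> norm u + norm (x t - z)" by (rule norm_triangle_ineq4)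
      finally have "(\<theta> * t * norm (x' t))\<^sup>2 \<le> (norm u + norm (x t - z))\<^sup>2"
        using par t by (intro power_mono) auto
      also have "\<dots> \<le> 2 * (norm u)\<^sup>2 + 2 * (norm (x t - z))\<^sup>2"
        using zero_le_power2[of "norm u - norm (x t - z)"] by (simp add: power2_sum power2_diff)
      also have "\<dots> \<le> 4 * E + 2 * (2 / m * E)" using E(2) xz by linarith
      finally have "\<theta>\<^sup>2 * (t\<^sup>2 * (norm (x' t))\<^sup>2) \<le> (4 + 4 / m) * E"
        by (simp add: power_mult_distrib algebra_simps)
      then show ?thesis using par by (simp add: pos_le_divide_eq mult.commute)
    qed
    ultimately show "t powr (\<beta> + 2) * bregman h z (x t) \<le> C * block_energy \<alpha> \<beta> c p \<theta> eps h x x' z t \<and>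
      (norm (x t - z))\<^sup>2 \<le> C * block_energy \<alpha> \<beta> c p \<theta> eps h x x' z t \<and>
      t\<^sup>2 * (norm (x' t))\<^sup>2 \<le> C * block_energy \<alpha> \<beta> c p \<theta> eps h x x' z t \<and>
      t powr (\<beta> + 2) * (norm (grad h (x t) - grad h z))\<^sup>2 \<le> C * block_energy \<alpha> \<beta> c p \<theta> eps h x x' z t"
      unfolding E_def[symmetric] B_def[symmetric] G_def[symmetric]
      using xz le_C[OF C(1)] le_C[OF C(2)] le_C[OF C(3)] le_C[OF C(4)] by linarith
  qed
qed

lemma block_dissipation_controls:
  assumes conv: "convex_on UNIV h" and diff: "\<And>u. h differentiable (at u)" and L: "L > 0"
    and par: "\<theta> > 0" "\<theta> * (\<alpha> - 1) > 1" "\<theta> * (\<beta> + 2) < 1"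
  shows "\<exists>C>0. \<forall>t>0.
      t * (norm (x' t))\<^sup>2 \<le> C * block_dissipation \<alpha> \<beta> \<theta> L h x x' z t \<and>
      t powr (\<beta> + 1) * bregman h z (x t) \<le> C * block_dissipation \<alpha> \<beta> \<theta> L h x x' z t \<and>
      t powr (\<beta> + 1) * (norm (grad h (x t) - grad h z))\<^sup>2 \<le> C * block_dissipation \<alpha> \<beta> \<theta> L h x x' z t"
proof -
  define k1 k2 k3 where k: "k1 = (\<theta> * (\<alpha> - 1) - 1) * \<theta>" "k2 = \<theta> * (1 - \<theta> * (\<beta> + 2))" "k3 = \<theta> / (2 * L)"
  have pos: "k1 > 0" "k2 > 0" "k3 > 0" using par L by (simp_all add: k)
  define C where "C = 1 / k1 + 1 / k2 + 1 / k3"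
  have C: "1 \<le> C * k1" "1 \<le> C * k2" "1 \<le> C * k3" "C > 0"
    using pos by (simp_all add: C_def field_simps add_pos_pos)
  show ?thesis
  proof (intro exI[of _ C] conjI[OF C(4)] allI impI)
    fix t :: real assume t: "t > 0"
    define a b d where abd: "a = t * (norm (x' t))\<^sup>2" "b = t powr (\<beta> + 1) * bregman h z (x t)"
      "d = t powr (\<beta> + 1) * (norm (grad h (x t) - grad h z))\<^sup>2"
    have nonneg: "0 \<le> a" "0 \<le> b" "0 \<le> d"
      using t bregman_nonneg[OF conv diff] by (simp_all add: abd)
    have "C * block_dissipation \<alpha> \<beta> \<theta> L h x x' z t = C * k1 * a + C * k2 * b + C * k3 * d"
      unfolding block_dissipation_def abd k[symmetric] by (simp add: algebra_simps)
    moreover have "1 * a \<le> C * k1 * a" "1 * b \<le> C * k2 * b" "1 * d \<le> C * k3 * d"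
      using C nonneg by (intro mult_right_mono; simp)+
    ultimately show "t * (norm (x' t))\<^sup>2 \<le> C * block_dissipation \<alpha> \<beta> \<theta> L h x x' z t \<and>
      t powr (\<beta> + 1) * bregman h z (x t) \<le> C * block_dissipation \<alpha> \<beta> \<theta> L h x x' z t \<and>
      t powr (\<beta> + 1) * (norm (grad h (x t) - grad h z))\<^sup>2 \<le> C * block_dissipation \<alpha> \<beta> \<theta> L h x x' z t"
      unfolding abd[symmetric] using nonneg by linarith
  qed
qed

section \<open>Solutions of the system\<close>

lemma continuous_on_of_differentiable:
  assumes "\<And>u. h differentiable (at u)"
  shows "continuous_on A h"
  using assms by (meson continuous_at_imp_continuous_on differentiable_imp_continuous_within)

text \<open>By the equations, the accelerations agree almost everywhere with continuous functions of time, so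
  solutions in the Sobolev sense are classical solutions.\<close>
lemma GTRD_solution_classical:
  assumes sol: "GTRD_solution f g K a b eps \<theta> t0 x x' y y'"
    and diff: "\<And>u. f differentiable (at u)" "\<And>v. g differentiable (at v)"
    and grad: "continuous_on UNIV (grad f)" "continuous_on UNIV (grad g)"
    and coeff: "continuous_on {t0<..} a" "continuous_on {t0<..} b" "continuous_on {t0<..} eps"
    and t: "t0 < t"
  shows "(x has_vector_derivative x' t) (at t)"
    and "(x' has_vector_derivative - a t *\<^sub>R x' t
          - b t *\<^sub>R (grad f (x t) + adjoint ((*v) K) (y t + (\<theta> * t) *\<^sub>R y' t) + eps t *\<^sub>R x t)) (at t)"
    and "(y has_vector_derivative y' t) (at t)"
    and "(y' has_vector_derivative - a t *\<^sub>R y' t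
          - b t *\<^sub>R (grad g (y t) - K *v (x t + (\<theta> * t) *\<^sub>R x' t) + eps t *\<^sub>R y t)) (at t)"
proof -
  define X where "X t = - a t *\<^sub>R x' t
    - b t *\<^sub>R (grad f (x t) + adjoint ((*v) K) (y t + (\<theta> * t) *\<^sub>R y' t) + eps t *\<^sub>R x t)" for t
  define Y where "Y t = - a t *\<^sub>R y' t
    - b t *\<^sub>R (grad g (y t) - K *v (x t + (\<theta> * t) *\<^sub>R x' t) + eps t *\<^sub>R y t)" for t
  obtain x'' y'' where W21: "W21_loc t0 x x' x''" "W21_loc t0 y y' y''"
    and ae: "AE t in lebesgue. t0 < t \<longrightarrow>
          x'' t + a t *\<^sub>R x' t
            + b t *\<^sub>R grad (\<lambda>u. reg_lagrangian f g K eps t u (y t + (\<theta> * t) *\<^sub>R y' t)) (x t) = 0 \<and>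
          y'' t + a t *\<^sub>R y' t
            - b t *\<^sub>R grad (\<lambda>v. reg_lagrangian f g K eps t (x t + (\<theta> * t) *\<^sub>R x' t) v) (y t) = 0"
    and cont: "continuous_on {t0..} x" "continuous_on {t0..} x'" "continuous_on {t0..} y" "continuous_on {t0..} y'"
    using sol unfolding GTRD_solution_def by blast
  have cont': "continuous_on {t0<..} x" "continuous_on {t0<..} x'" "continuous_on {t0<..} y" "continuous_on {t0<..} y'"
    using cont by (auto elim: continuous_on_subset)
  have lin: "bounded_linear ((*v) K)" "bounded_linear (adjoint ((*v) K))"
    by (auto intro!: linear_conv_bounded_linear[THEN iffD1] adjoint_linear)
  have gc: "continuous_on {t0<..} (\<lambda>t. grad f (x t))" "continuous_on {t0<..} (\<lambda>t. grad g (y t))"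
    by (auto intro: continuous_on_compose2[OF grad(1) cont'(1)] continuous_on_compose2[OF grad(2) cont'(3)])
  have XY: "continuous_on {t0<..} X" "continuous_on {t0<..} Y"
    unfolding X_def Y_def
    by (intro continuous_intros coeff cont' gc bounded_linear.continuous_on[OF lin(1)] bounded_linear.continuous_on[OF lin(2)])+
  have aeX: "AE t in lebesgue. t0 < t \<longrightarrow> x'' t = X t"
    using ae
  proof eventually_elim
    case (elim t)
    then show ?case
      unfolding grad_x_reg_lagrangian[OF diff(1)] X_def
      by (simp add: algebra_simps) (metis (no_types, lifting) add.commute add.left_commute eq_neg_iff_add_eq_0 minus_add_distrib)
  qed
  have aeY: "AE t in lebesgue. t0 < t \<longrightarrow> y'' t = Y t"
    using ae
  proof eventually_elim
    case (elim t)
    then have "t0 < t \<longrightarrow> y'' t + a t *\<^sub>R y' t - b t *\<^sub>R (- grad g (y t) + K *v (x t + (\<theta> * t) *\<^sub>R x' t) - eps t *\<^sub>R y t) = 0"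
      unfolding grad_y_reg_lagrangian[OF diff(2)] by simp
    then show ?case
      unfolding Y_def by (simp add: algebra_simps)
  qed
  show "(x has_vector_derivative x' t) (at t)" "(y has_vector_derivative y' t) (at t)"
    using W21 unfolding W21_loc_def
    by (auto intro: weak_derivative_imp_has_vector_derivative[OF cont'(1,2) _ t] weak_derivative_imp_has_vector_derivative[OF cont'(3,4) _ t])
  have "weak_derivative t0 x' X" "weak_derivative t0 y' Y"
    using W21 unfolding W21_loc_def
    by (auto intro: weak_derivative_cong_AE[OF _ aeX XY(1)] weak_derivative_cong_AE[OF _ aeY XY(2)])
  then have "(x' has_vector_derivative X t) (at t)" "(y' has_vector_derivative Y t) (at t)"
    using weak_derivative_imp_has_vector_derivative cont' XY t by blast+
  then show "(x' has_vector_derivative - a t *\<^sub>R x' t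
          - b t *\<^sub>R (grad f (x t) + adjoint ((*v) K) (y t + (\<theta> * t) *\<^sub>R y' t) + eps t *\<^sub>R x t)) (at t)"
    "(y' has_vector_derivative - a t *\<^sub>R y' t
          - b t *\<^sub>R (grad g (y t) - K *v (x t + (\<theta> * t) *\<^sub>R x' t) + eps t *\<^sub>R y t)) (at t)"
    by (simp_all add: X_def Y_def)
qed

lemma continuous_on_block:
  fixes x x' :: "real \<Rightarrow> 'a::euclidean_space"
  assumes x: "continuous_on {t0..} x" and x': "continuous_on {t0..} x'" and eps: "continuous_on {t0..} eps"
    and diff: "\<And>u. h differentiable (at u)" and grad: "continuous_on UNIV (grad h)" and t0: "t0 > 0"
  shows "continuous_on {t0..} (block_energy \<alpha> \<beta> c p \<theta> eps h x x' z)"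
    and "continuous_on {t0..} (block_dissipation \<alpha> \<beta> \<theta> L h x x' z)"
    and "continuous_on {t0..} (\<lambda>t. bregman h z (x t))"
    and "continuous_on {t0..} (\<lambda>t. grad h (x t))"
proof -
  have hx: "continuous_on {t0..} (\<lambda>t. h (x t))"
    by (rule continuous_on_compose2[OF continuous_on_of_differentiable[OF diff] x]) auto
  show gx: "continuous_on {t0..} (\<lambda>t. grad h (x t))"
    by (rule continuous_on_compose2[OF grad x]) auto
  show bx: "continuous_on {t0..} (\<lambda>t. bregman h z (x t))"
    unfolding bregman_def by (intro continuous_intros hx x)
  show "continuous_on {t0..} (block_energy \<alpha> \<beta> c p \<theta> eps h x x' z)"
    unfolding block_energy_def[abs_def] using t0 by (intro continuous_intros bx x x' eps) auto
  show "continuous_on {t0..} (block_dissipation \<alpha> \<beta> \<theta> L h x x' z)"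
    unfolding block_dissipation_def[abs_def] using t0 by (intro continuous_intros bx gx x x') auto
qed
section \<open>Convergence rates\<close>

theorem theorem3p3:
  fixes f :: "real^'n \<Rightarrow> real" and g :: "real^'m \<Rightarrow> real" and K :: "real^'n^'m"
    and L1 L2 c p \<alpha> \<beta> \<theta> t0 :: real and eps :: "real \<Rightarrow> real"
    and x x' :: "real \<Rightarrow> real^'n" and y y' :: "real \<Rightarrow> real^'m"
    and xs :: "real^'n" and ys :: "real^'m"
  assumes f_convex: "convex_on UNIV f" and g_convex: "convex_on UNIV g"
    and f_diff: "\<And>u. f differentiable (at u)" and g_diff: "\<And>v. g differentiable (at v)"
    and f_C1: "continuous_on UNIV (grad f)" and g_C1: "continuous_on UNIV (grad g)"
    and L1: "L1 > 0" and L2: "L2 > 0"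
    and f_lip: "L1-lipschitz_on UNIV (grad f)" and g_lip: "L2-lipschitz_on UNIV (grad g)"
    and c: "c \<ge> 0" and p: "p > 1" and \<alpha>: "\<alpha> \<ge> 3" and \<beta>: "\<beta> \<ge> 0" and \<alpha>\<beta>: "\<alpha> > \<beta> + 3"
    and t0: "t0 \<ge> 1"
    and \<theta>: "1 / (\<alpha> - 1) < \<theta>" "\<theta> < 1 / (\<beta> + 2)"
    and eps_pos: "\<And>t. t \<ge> t0 \<Longrightarrow> eps t > 0"
    and eps_antimono: "antimono_on {t0..} eps"
    and eps_C1: "\<exists>eps'. continuous_on {t0..} eps' \<and>
           (\<forall>t\<ge>t0. (eps has_real_derivative eps' t) (at t within {t0..}))"
    and eps_lim: "(eps \<longlongrightarrow> 0) at_top"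
    and sol: "GTRD_solution f g K (\<lambda>t. \<alpha> / t + c / t powr p) (\<lambda>t. t powr \<beta>) eps \<theta> t0 x x' y y'"
    and saddle: "(xs, ys) \<in> saddle_points f g K"
  shows
    "(set_integrable lebesgue {t0..} (\<lambda>t. t powr (\<beta> + 1) * eps t) \<longrightarrow>
        bounded ((\<lambda>t. (x t, y t)) ` {t0..}) \<and>
        (\<lambda>t. lagrangian f g K (x t) ys - lagrangian f g K xs (y t)) \<in> O[at_top](\<lambda>t. t powr (- \<beta> - 2)) \<and>
        (\<lambda>t. norm (x' t)) \<in> O[at_top](\<lambda>t. 1 / t) \<and>
        (\<lambda>t. norm (y' t)) \<in> O[at_top](\<lambda>t. 1 / t) \<and>
        (\<lambda>t. norm (grad f (x t) - grad f xs)) \<in> O[at_top](\<lambda>t. t powr (- ((\<beta> + 2) / 2))) \<and>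
        (\<lambda>t. norm (grad g (y t) - grad g ys)) \<in> O[at_top](\<lambda>t. t powr (- ((\<beta> + 2) / 2))) \<and>
        set_integrable lebesgue {t0..} (\<lambda>t. t * ((norm (x' t))\<^sup>2 + (norm (y' t))\<^sup>2)) \<and>
        set_integrable lebesgue {t0..}
          (\<lambda>t. t powr (\<beta> + 1) * (lagrangian f g K (x t) ys - lagrangian f g K xs (y t))) \<and>
        set_integrable lebesgue {t0..}
          (\<lambda>t. t powr (\<beta> + 1) * (norm (grad f (x t) - grad f xs))\<^sup>2) \<and>
        set_integrable lebesgue {t0..}
          (\<lambda>t. t powr (\<beta> + 1) * (norm (grad g (y t) - grad g ys))\<^sup>2)) \<and>
     (set_integrable lebesgue {t0..} (\<lambda>t. t powr (\<beta> - 1) * eps t) \<longrightarrow>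
        ((\<lambda>t. norm (x' t)) \<longlongrightarrow> 0) at_top \<and>
        ((\<lambda>t. norm (y' t)) \<longlongrightarrow> 0) at_top \<and>
        ((\<lambda>t. lagrangian f g K (x t) ys - lagrangian f g K xs (y t)) \<longlongrightarrow> 0) at_top \<and>
        (\<beta> > 0 \<longrightarrow>
          (\<lambda>t. lagrangian f g K (x t) ys - lagrangian f g K xs (y t)) \<in> o[at_top](\<lambda>t. t powr (- \<beta>)) \<and>
          (\<lambda>t. norm (grad f (x t) - grad f xs)) \<in> o[at_top](\<lambda>t. t powr (- (\<beta> / 2))) \<and>
          (\<lambda>t. norm (grad g (y t) - grad g ys)) \<in> o[at_top](\<lambda>t. t powr (- (\<beta> / 2)))))"
proof -
  define a where "a t = \<alpha> / t + c / t powr p" for t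
  define b where "b t = t powr \<beta>" for t :: real
  obtain eps' where eps': "\<And>t. t \<ge> t0 \<Longrightarrow> (eps has_real_derivative eps' t) (at t within {t0..})"
    using eps_C1 by blast
  have eps_cont: "continuous_on {t0..} eps"
    using eps' by (intro DERIV_continuous_on) auto
  have eps_deriv: "(eps has_real_derivative eps' t) (at t)" "eps' t \<le> 0" if "t0 < t" for t
  proof -
    have "at t within {t0..} = at t" using that by (intro at_within_interior) auto
    then show d: "(eps has_real_derivative eps' t) (at t)" using eps'[of t] that by simp
    have "mono_on {t0..} (\<lambda>t. - eps t)"
      using eps_antimono by (auto simp: monotone_on_def)
    from mono_on_imp_deriv_nonneg[OF this DERIV_minus[OF d]] that show "eps' t \<le> 0" by simp
  qed
  have cont: "continuous_on {t0..} x" "continuous_on {t0..} x'" "continuous_on {t0..} y" "continuous_on {t0..} y'"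
    using sol unfolding GTRD_solution_def by auto
  have coeff: "continuous_on {t0<..} a" "continuous_on {t0<..} b" "continuous_on {t0<..} eps"
    unfolding a_def b_def using t0
    by (auto intro!: continuous_intros continuous_on_subset[OF eps_cont])
  have sol': "GTRD_solution f g K a b eps \<theta> t0 x x' y y'"
    using sol unfolding a_def[abs_def] b_def[abs_def] .
  note classical = GTRD_solution_classical[OF sol' f_diff g_diff f_C1 g_C1 coeff]
  have \<theta>1: "\<theta> * (\<alpha> - 1) > 1" and \<theta>2: "\<theta> * (\<beta> + 2) < 1"
    using \<theta> \<alpha> \<beta> by (simp_all add: field_simps)
  have \<theta>0: "\<theta> > 0" using \<theta>(1) \<alpha> by (smt (verit) divide_pos_pos)
  have t0': "t0 > 0" using t0 by simp

  \<comment> \<open>The anchored vectors, which are also the ones through which the two equations are coupled.\<close>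
  define u where "u t = x t - xs + (\<theta> * t) *\<^sub>R x' t" for t
  define v where "v t = y t - ys + (\<theta> * t) *\<^sub>R y' t" for t
  define gap where "gap t = lagrangian f g K (x t) ys - lagrangian f g K xs (y t)" for t
  have gap_eq: "gap t = bregman f xs (x t) + bregman g ys (y t)" for t
    unfolding gap_def by (rule lagrangian_gap_eq_bregman[OF f_diff g_diff saddle])
  define E1 where "E1 = block_energy \<alpha> \<beta> c p \<theta> eps f x x' xs"
  define E2 where "E2 = block_energy \<alpha> \<beta> c p \<theta> eps g y y' ys"
  define W1 where "W1 = block_dissipation \<alpha> \<beta> \<theta> L1 f x x' xs"
  define W2 where "W2 = block_dissipation \<alpha> \<beta> \<theta> L2 g y y' ys"
  define R where "R t = \<theta> / 2 * ((norm xs)\<^sup>2 + (norm ys)\<^sup>2) * (t powr (\<beta> + 1) * eps t)" for t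
  note block1 = continuous_on_block[OF cont(1,2) eps_cont f_diff f_C1 t0']
  note block2 = continuous_on_block[OF cont(3,4) eps_cont g_diff g_C1 t0']
  have cont_block: "continuous_on {t0..} E1" "continuous_on {t0..} E2" "continuous_on {t0..} W1" "continuous_on {t0..} W2"
    "continuous_on {t0..} (\<lambda>t. grad f (x t))" "continuous_on {t0..} (\<lambda>t. grad g (y t))"
    unfolding E1_def E2_def W1_def W2_def
    by (rule block1(1,2,4) block2(1,2,4))+
  have cont_gap: "continuous_on {t0..} gap"
    unfolding gap_eq[abs_def]
    by (intro continuous_on_add block1(3) block2(3))
  have cont_eps_powr: "continuous_on {t0..} (\<lambda>t. t powr r * eps t)" for r
    using t0' by (intro continuous_intros eps_cont) auto

  have "\<exists>D. ((\<lambda>t. E1 t + E2 t) has_real_derivative D) (at t) \<and> D \<le> R t - (W1 t + W2 t)"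
    if t: "t0 < t" for t
  proof -
    have tpos: "t > 0" and eps_nn: "eps t \<ge> 0" using t t0' eps_pos[of t] by auto
    note stat = saddle_point_stationary[OF f_diff g_diff saddle]
    have lin: "linear ((*v) K)" "linear (adjoint ((*v) K))"
      by (auto intro: adjoint_linear)
    have "- a t *\<^sub>R x' t - b t *\<^sub>R (grad f (x t) + adjoint ((*v) K) (y t + (\<theta> * t) *\<^sub>R y' t) + eps t *\<^sub>R x t)
        = - (\<alpha> / t + c / t powr p) *\<^sub>R x' t
          - (t powr \<beta>) *\<^sub>R (grad f (x t) - grad f xs + adjoint ((*v) K) (v t) + eps t *\<^sub>R x t)"
    proof -
      have "adjoint ((*v) K) (y t + (\<theta> * t) *\<^sub>R y' t) = adjoint ((*v) K) (v t) + adjoint ((*v) K) ys"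
        unfolding linear_add[OF lin(2), symmetric] by (simp add: v_def)
      then show ?thesis using stat by (simp add: a_def b_def)
    qed
    then obtain D1 where D1: "(E1 has_real_derivative D1) (at t)"
      "D1 \<le> \<theta> * t powr (\<beta> + 1) * eps t / 2 * (norm xs)\<^sup>2 - W1 t - \<theta> * t powr (\<beta> + 1) * (u t \<bullet> adjoint ((*v) K) (v t))"
      using block_energy_derivative[OF f_convex f_diff f_lip L1 c p \<theta>0 less_imp_le[OF \<theta>2] tpos
          eps_deriv(1)[OF t] eps_nn eps_deriv(2)[OF t] classical(1)[OF t] classical(2)[OF t]]
      unfolding E1_def W1_def u_def by blast
    have "- a t *\<^sub>R y' t - b t *\<^sub>R (grad g (y t) - K *v (x t + (\<theta> * t) *\<^sub>R x' t) + eps t *\<^sub>R y t)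
        = - (\<alpha> / t + c / t powr p) *\<^sub>R y' t
          - (t powr \<beta>) *\<^sub>R (grad g (y t) - grad g ys + (- (K *v u t)) + eps t *\<^sub>R y t)"
    proof -
      have "K *v (x t + (\<theta> * t) *\<^sub>R x' t) = K *v u t + K *v xs"
        unfolding linear_add[OF lin(1), symmetric] by (simp add: u_def)
      then show ?thesis using stat by (simp add: a_def b_def)
    qed
    then obtain D2 where D2: "(E2 has_real_derivative D2) (at t)"
      "D2 \<le> \<theta> * t powr (\<beta> + 1) * eps t / 2 * (norm ys)\<^sup>2 - W2 t - \<theta> * t powr (\<beta> + 1) * (v t \<bullet> (- (K *v u t)))"
      using block_energy_derivative[OF g_convex g_diff g_lip L2 c p \<theta>0 less_imp_le[OF \<theta>2] tpos
          eps_deriv(1)[OF t] eps_nn eps_deriv(2)[OF t] classical(3)[OF t] classical(4)[OF t]]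
      unfolding E2_def W2_def v_def by blast
    \<comment> \<open>The two coupling terms cancel because \<open>K\<close> and its adjoint enter with opposite signs.\<close>
    have "u t \<bullet> adjoint ((*v) K) (v t) + v t \<bullet> (- (K *v u t)) = 0"
      using adjoint_works[OF lin(1), of "u t" "v t"] by (simp add: inner_commute)
    then have "\<theta> * t powr (\<beta> + 1) * (u t \<bullet> adjoint ((*v) K) (v t)) + \<theta> * t powr (\<beta> + 1) * (v t \<bullet> (- (K *v u t))) = 0"
      unfolding distrib_left[symmetric] by simp
    moreover have "\<theta> * t powr (\<beta> + 1) * eps t / 2 * (norm xs)\<^sup>2 + \<theta> * t powr (\<beta> + 1) * eps t / 2 * (norm ys)\<^sup>2 = R t"
      by (simp add: R_def algebra_simps add_divide_distrib)
    ultimately have "D1 + D2 \<le> R t - (W1 t + W2 t)" using D1(2) D2(2) by linarith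
    then show ?thesis using DERIV_add[OF D1(1) D2(1)] by blast
  qed
  moreover have "continuous_on {t0..} R"
    unfolding R_def[abs_def] by (intro continuous_on_mult_left cont_eps_powr)
  ultimately have energy: "E1 T + E2 T + integral {t0..T} (\<lambda>t. W1 t + W2 t) \<le> E1 t0 + E2 t0 + integral {t0..T} R"
    if "t0 \<le> T" for T
    using that by (intro energy_dissipation_inequality continuous_on_add cont_block) auto
  have int_R: "integral {t0..T} R = \<theta> / 2 * ((norm xs)\<^sup>2 + (norm ys)\<^sup>2) * integral {t0..T} (\<lambda>t. t powr (\<beta> + 1) * eps t)" for T
    unfolding R_def[abs_def] by simp

  obtain C1 where C1: "C1 > 0" "\<forall>t>0. eps t \<ge> 0 \<longrightarrow> t powr (\<beta> + 2) * bregman f xs (x t) \<le> C1 * E1 t \<and>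
      (norm (x t - xs))\<^sup>2 \<le> C1 * E1 t \<and> t\<^sup>2 * (norm (x' t))\<^sup>2 \<le> C1 * E1 t \<and>
      t powr (\<beta> + 2) * (norm (grad f (x t) - grad f xs))\<^sup>2 \<le> C1 * E1 t"
    using block_energy_controls[OF f_convex f_diff f_lip L1 c \<theta>0 \<theta>1, where eps = eps and \<beta> = \<beta> and x = x and z = xs and x' = x' and p = p] unfolding E1_def by blast
  obtain C2 where C2: "C2 > 0" "\<forall>t>0. eps t \<ge> 0 \<longrightarrow> t powr (\<beta> + 2) * bregman g ys (y t) \<le> C2 * E2 t \<and>
      (norm (y t - ys))\<^sup>2 \<le> C2 * E2 t \<and> t\<^sup>2 * (norm (y' t))\<^sup>2 \<le> C2 * E2 t \<and>
      t powr (\<beta> + 2) * (norm (grad g (y t) - grad g ys))\<^sup>2 \<le> C2 * E2 t"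
    using block_energy_controls[OF g_convex g_diff g_lip L2 c \<theta>0 \<theta>1, where eps = eps and \<beta> = \<beta> and x = y and z = ys and x' = y' and p = p] unfolding E2_def by blast
  obtain C3 where C3: "C3 > 0" "\<forall>t>0. t * (norm (x' t))\<^sup>2 \<le> C3 * W1 t \<and>
      t powr (\<beta> + 1) * bregman f xs (x t) \<le> C3 * W1 t \<and>
      t powr (\<beta> + 1) * (norm (grad f (x t) - grad f xs))\<^sup>2 \<le> C3 * W1 t"
    using block_dissipation_controls[OF f_convex f_diff L1 \<theta>0 \<theta>1 \<theta>2, where x' = x' and x = x and z = xs] unfolding W1_def by blast
  obtain C4 where C4: "C4 > 0" "\<forall>t>0. t * (norm (y' t))\<^sup>2 \<le> C4 * W2 t \<and>
      t powr (\<beta> + 1) * bregman g ys (y t) \<le> C4 * W2 t \<and>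
      t powr (\<beta> + 1) * (norm (grad g (y t) - grad g ys))\<^sup>2 \<le> C4 * W2 t"
    using block_dissipation_controls[OF g_convex g_diff L2 \<theta>0 \<theta>1 \<theta>2, where x' = y' and x = y and z = ys] unfolding W2_def by blast
  \<comment> \<open>A common constant; the factor \<open>2\<close> below accounts for sums over the two variables.\<close>
  define C where "C = C1 + C2 + C3 + C4"
  define E where "E t = E1 t + E2 t" for t
  define W where "W t = W1 t + W2 t" for t
  have C: "C > 0" using C1 C2 C3 C4 by (simp add: C_def)
  have nonneg: "0 \<le> E1 t" "0 \<le> E2 t" "0 \<le> W1 t" "0 \<le> W2 t" "0 \<le> bregman f xs (x t)" "0 \<le> bregman g ys (y t)"
    if "t0 \<le> t" for t
  proof -
    have t: "t > 0" "eps t \<ge> 0" using that t0' eps_pos[of t] by auto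
    have "0 \<le> C1 * E1 t" using C1(2) t by (meson order_trans zero_le_power2)
    then show "0 \<le> E1 t" using C1(1) by (simp add: zero_le_mult_iff)
    have "0 \<le> C2 * E2 t" using C2(2) t by (meson order_trans zero_le_power2)
    then show "0 \<le> E2 t" using C2(1) by (simp add: zero_le_mult_iff)
    have "0 \<le> t * (norm (x' t))\<^sup>2" "0 \<le> t * (norm (y' t))\<^sup>2" using t by simp_all
    then have "0 \<le> C3 * W1 t" "0 \<le> C4 * W2 t" using C3(2) C4(2) t by (meson order_trans)+
    then show "0 \<le> W1 t" "0 \<le> W2 t" using C3(1) C4(1) by (simp_all add: zero_le_mult_iff)
  qed (intro bregman_nonneg f_convex g_convex f_diff g_diff)+
  have E_control: "t powr (\<beta> + 2) * gap t \<le> 2 * C * E t" "(norm (x t - xs))\<^sup>2 \<le> 2 * C * E t" "(norm (y t - ys))\<^sup>2 \<le> 2 * C * E t"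
    "t\<^sup>2 * (norm (x' t))\<^sup>2 \<le> 2 * C * E t" "t\<^sup>2 * (norm (y' t))\<^sup>2 \<le> 2 * C * E t"
    "t powr (\<beta> + 2) * (norm (grad f (x t) - grad f xs))\<^sup>2 \<le> 2 * C * E t"
    "t powr (\<beta> + 2) * (norm (grad g (y t) - grad g ys))\<^sup>2 \<le> 2 * C * E t" "0 \<le> E t"
    if "t0 \<le> t" for t
  proof -
    have t: "t > 0" "eps t \<ge> 0" using that t0' eps_pos[of t] by auto
    have "C1 * E1 t \<le> C * E t" "C2 * E2 t \<le> C * E t"
      using nonneg[OF that] C1 C2 C3 C4 unfolding C_def E_def by (auto intro!: mult_mono)
    moreover have "0 \<le> C * E t" using nonneg[OF that] C unfolding E_def by simp
    moreover have "t powr (\<beta> + 2) * gap t = t powr (\<beta> + 2) * bregman f xs (x t) + t powr (\<beta> + 2) * bregman g ys (y t)"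
      by (simp add: gap_eq distrib_left)
    ultimately show "t powr (\<beta> + 2) * gap t \<le> 2 * C * E t" "(norm (x t - xs))\<^sup>2 \<le> 2 * C * E t" "(norm (y t - ys))\<^sup>2 \<le> 2 * C * E t"
      "t\<^sup>2 * (norm (x' t))\<^sup>2 \<le> 2 * C * E t" "t\<^sup>2 * (norm (y' t))\<^sup>2 \<le> 2 * C * E t"
      "t powr (\<beta> + 2) * (norm (grad f (x t) - grad f xs))\<^sup>2 \<le> 2 * C * E t"
      "t powr (\<beta> + 2) * (norm (grad g (y t) - grad g ys))\<^sup>2 \<le> 2 * C * E t"
      using C1(2)[rule_format, OF t] C2(2)[rule_format, OF t] by linarith+
    show "0 \<le> E t" using nonneg[OF that] by (simp add: E_def)
  qed
  have W_control: "t * ((norm (x' t))\<^sup>2 + (norm (y' t))\<^sup>2) \<le> 2 * C * W t"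
    "t powr (\<beta> + 1) * gap t \<le> 2 * C * W t"
    "t powr (\<beta> + 1) * (norm (grad f (x t) - grad f xs))\<^sup>2 \<le> 2 * C * W t"
    "t powr (\<beta> + 1) * (norm (grad g (y t) - grad g ys))\<^sup>2 \<le> 2 * C * W t" "0 \<le> W t"
    if "t0 \<le> t" for t
  proof -
    have t: "t > 0" using that t0' by auto
    have "C3 * W1 t \<le> C * W t" "C4 * W2 t \<le> C * W t"
      using nonneg[OF that] C1 C2 C3 C4 unfolding C_def W_def by (auto intro!: mult_mono)
    moreover have "0 \<le> C * W t" using nonneg[OF that] C unfolding W_def by simp
    ultimately show "t * ((norm (x' t))\<^sup>2 + (norm (y' t))\<^sup>2) \<le> 2 * C * W t"
      "t powr (\<beta> + 1) * gap t \<le> 2 * C * W t"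
      "t powr (\<beta> + 1) * (norm (grad f (x t) - grad f xs))\<^sup>2 \<le> 2 * C * W t"
      "t powr (\<beta> + 1) * (norm (grad g (y t) - grad g ys))\<^sup>2 \<le> 2 * C * W t"
      using C3(2)[rule_format, OF t] C4(2)[rule_format, OF t] unfolding gap_eq distrib_left by linarith+
    show "0 \<le> W t" using nonneg[OF that] by (simp add: W_def)
  qed
  have gap_nonneg: "0 \<le> gap t" if "t0 \<le> t" for t
    using nonneg(5,6)[OF that] by (simp add: gap_eq)
  have W_cont: "continuous_on {t0..} W"
    unfolding W_def[abs_def] by (intro continuous_on_add cont_block)
  have W_int_nonneg: "0 \<le> integral {t0..T} W" for T
    using W_control(5) W_cont
    by (intro integral_nonneg integrable_continuous_real) (auto elim: continuous_on_subset)

  \<comment> \<open>In the first case the energy and the total dissipation are bounded.\<close>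
  have part1: "bounded ((\<lambda>t. (x t, y t)) ` {t0..}) \<and>
        gap \<in> O[at_top](\<lambda>t. t powr (- \<beta> - 2)) \<and>
        (\<lambda>t. norm (x' t)) \<in> O[at_top](\<lambda>t. 1 / t) \<and>
        (\<lambda>t. norm (y' t)) \<in> O[at_top](\<lambda>t. 1 / t) \<and>
        (\<lambda>t. norm (grad f (x t) - grad f xs)) \<in> O[at_top](\<lambda>t. t powr (- ((\<beta> + 2) / 2))) \<and>
        (\<lambda>t. norm (grad g (y t) - grad g ys)) \<in> O[at_top](\<lambda>t. t powr (- ((\<beta> + 2) / 2))) \<and>
        set_integrable lebesgue {t0..} (\<lambda>t. t * ((norm (x' t))\<^sup>2 + (norm (y' t))\<^sup>2)) \<and>
        set_integrable lebesgue {t0..} (\<lambda>t. t powr (\<beta> + 1) * gap t) \<and>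
        set_integrable lebesgue {t0..}
          (\<lambda>t. t powr (\<beta> + 1) * (norm (grad f (x t) - grad f xs))\<^sup>2) \<and>
        set_integrable lebesgue {t0..}
          (\<lambda>t. t powr (\<beta> + 1) * (norm (grad g (y t) - grad g ys))\<^sup>2)"
    if int: "set_integrable lebesgue {t0..} (\<lambda>t. t powr (\<beta> + 1) * eps t)"
  proof -
    define M where "M = E t0 + \<theta> / 2 * ((norm xs)\<^sup>2 + (norm ys)\<^sup>2) * integral {t0..} (\<lambda>t. t powr (\<beta> + 1) * eps t)"
    have "integral {t0..T} R \<le> \<theta> / 2 * ((norm xs)\<^sup>2 + (norm ys)\<^sup>2) * integral {t0..} (\<lambda>t. t powr (\<beta> + 1) * eps t)" for T
      unfolding int_R using \<theta>0 eps_pos by (intro mult_left_mono integral_le_atLeast[OF int]) (simp_all add: less_imp_le)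
    then have energy': "E T + integral {t0..T} W \<le> M" if "t0 \<le> T" for T
      using energy[OF that] unfolding E_def W_def M_def by (smt (verit))
    have E_le: "2 * C * E t \<le> 2 * C * M" if "t0 \<le> t" for t
      using energy'[OF that] W_int_nonneg[of t] C by simp
    have W_le: "integral {t0..T} W \<le> M" if "t0 \<le> T" for T
      using energy'[OF that] E_control(8)[OF that] by simp
    have integrable: "set_integrable lebesgue {t0..} w"
      if "continuous_on {t0..} w" "\<And>t. t0 \<le> t \<Longrightarrow> 0 \<le> w t" "\<And>t. t0 \<le> t \<Longrightarrow> w t \<le> 2 * C * W t" for w
    proof (rule set_integrable_atLeast_nonneg[OF that(1,2)])
      fix T assume T: "t0 \<le> T"
      have "integral {t0..T} w \<le> integral {t0..T} (\<lambda>t. 2 * C * W t)"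
        using that(1,3) W_cont
        by (intro integral_le integrable_continuous_real continuous_intros) (auto elim: continuous_on_subset)
      also have "\<dots> = 2 * C * integral {t0..T} W" by simp
      also have "\<dots> \<le> 2 * C * M" using W_le[OF T] C by simp
      finally show "integral {t0..T} w \<le> 2 * C * M" .
    qed auto
    have bounded_by: "norm w \<le> sqrt (2 * C * M)" if "(norm w)\<^sup>2 \<le> 2 * C * E t" "t0 \<le> t" for t and w :: "'z::real_normed_vector"
      using that E_le[OF that(2)] by (intro real_le_rsqrt) linarith
    have ev: "\<forall>\<^sub>F t in at_top. k t \<le> 2 * C * M" if "\<And>t. t0 \<le> t \<Longrightarrow> k t \<le> 2 * C * E t" for k
      using eventually_ge_at_top[of t0]
      by eventually_elim (use that E_le in \<open>meson order_trans\<close>)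
    have rate: "q \<in> O[at_top](\<lambda>t. t powr (- (r / 2)))"
      if "\<And>t. 0 \<le> q t" "\<And>t. t0 \<le> t \<Longrightarrow> t powr r * (q t)\<^sup>2 \<le> 2 * C * E t" for q r
      using that by (intro bigo_of_weighted_square[where C = "2 * C * M"] ev)
    have rate1: "q \<in> O[at_top](\<lambda>t. 1 / t)"
      if "\<And>t. 0 \<le> q t" "\<And>t. t0 \<le> t \<Longrightarrow> t\<^sup>2 * (q t)\<^sup>2 \<le> 2 * C * E t" for q
    proof -
      have "q \<in> O[at_top](\<lambda>t. t powr (- (2 / 2)))"
        using that t0' by (intro rate) (auto simp: powr_numeral)
      moreover have "\<forall>\<^sub>F t in at_top. t powr (- (2 / 2)) = 1 / (t :: real)"
        using eventually_gt_at_top[of "0::real"] by eventually_elim (simp add: powr_minus_divide)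
      ultimately show ?thesis by (simp only: landau_o.big.cong)
    qed
    have "norm (x t, y t) \<le> norm xs + sqrt (2 * C * M) + (norm ys + sqrt (2 * C * M))" if "t0 \<le> t" for t
    proof -
      have "norm (x t - xs) \<le> sqrt (2 * C * M)" "norm (y t - ys) \<le> sqrt (2 * C * M)"
        using E_control(2,3)[OF that] that by (auto intro!: bounded_by)
      moreover have "norm (x t) \<le> norm xs + norm (x t - xs)" "norm (y t) \<le> norm ys + norm (y t - ys)"
        by (metis add.commute norm_triangle_sub)+
      moreover have "norm (x t, y t) \<le> norm (x t) + norm (y t)" by (rule norm_Pair_le)
      ultimately show ?thesis by linarith
    qed
    then have bdd: "bounded ((\<lambda>t. (x t, y t)) ` {t0..})"
      unfolding bounded_iff by auto
    have gap_rate: "gap \<in> O[at_top](\<lambda>t. t powr (- \<beta> - 2))"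
    proof (rule bigoI)
      have "\<forall>\<^sub>F t in at_top. t powr (\<beta> + 2) * gap t \<le> 2 * C * M"
        by (intro ev E_control(1))
      then show "\<forall>\<^sub>F t in at_top. norm (gap t) \<le> 2 * C * M * norm (t powr (- \<beta> - 2))"
        using eventually_ge_at_top[of t0]
      proof eventually_elim
        case (elim t)
        have "t powr (\<beta> + 2) * t powr (- \<beta> - 2) = 1"
          using elim t0' by (simp flip: powr_add)
        then have "gap t = (t powr (\<beta> + 2) * gap t) * t powr (- \<beta> - 2)"
          by (metis mult.assoc mult.commute mult_1)
        also have "\<dots> \<le> 2 * C * M * t powr (- \<beta> - 2)"
          using elim by (intro mult_right_mono) auto
        finally show ?case using gap_nonneg[of t] elim by simp
      qed
    qed
    have cont_w: "continuous_on {t0..} (\<lambda>t. t * ((norm (x' t))\<^sup>2 + (norm (y' t))\<^sup>2))"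
      "continuous_on {t0..} (\<lambda>t. t powr (\<beta> + 1) * gap t)"
      "continuous_on {t0..} (\<lambda>t. t powr (\<beta> + 1) * (norm (grad f (x t) - grad f xs))\<^sup>2)"
      "continuous_on {t0..} (\<lambda>t. t powr (\<beta> + 1) * (norm (grad g (y t) - grad g ys))\<^sup>2)"
      using t0' by (intro continuous_intros cont cont_gap cont_block; auto)+
    show ?thesis
      using t0' gap_nonneg
      by (intro conjI bdd gap_rate rate rate1 integrable cont_w W_control E_control) auto
  qed

  \<comment> \<open>In the second case the energy is \<open>o(t\<^sup>2)\<close>: since \<open>t powr (\<beta> + 1) = t\<^sup>2 * t powr (\<beta> - 1)\<close>, the
     bound for the energy is a constant plus a square-weighted integral of an integrable function.\<close>
  have part2: "((\<lambda>t. norm (x' t)) \<longlongrightarrow> 0) at_top \<and>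
        ((\<lambda>t. norm (y' t)) \<longlongrightarrow> 0) at_top \<and>
        (gap \<longlongrightarrow> 0) at_top \<and>
        (\<beta> > 0 \<longrightarrow>
          gap \<in> o[at_top](\<lambda>t. t powr (- \<beta>)) \<and>
          (\<lambda>t. norm (grad f (x t) - grad f xs)) \<in> o[at_top](\<lambda>t. t powr (- (\<beta> / 2))) \<and>
          (\<lambda>t. norm (grad g (y t) - grad g ys)) \<in> o[at_top](\<lambda>t. t powr (- (\<beta> / 2))))"
    if int: "set_integrable lebesgue {t0..} (\<lambda>t. t powr (\<beta> - 1) * eps t)"
  proof -
    define J where "J t = integral {t0..t} (\<lambda>s. s\<^sup>2 * (s powr (\<beta> - 1) * eps s))" for t
    have "((\<lambda>t. J t / t\<^sup>2) \<longlongrightarrow> 0) at_top"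
      unfolding J_def using t0' eps_pos
      by (intro integral_square_weight_tendsto_0[OF _ cont_eps_powr _ integral_le_atLeast[OF int]])
         (auto intro: less_imp_le)
    moreover have "((\<lambda>t. E t0 / t\<^sup>2) \<longlongrightarrow> 0) at_top"
      by (intro tendsto_divide_0[OF tendsto_const] filterlim_at_top_imp_at_infinity
          filterlim_pow_at_top filterlim_ident) auto
    ultimately have upper: "((\<lambda>t. 2 * C * (E t0 / t\<^sup>2 + \<theta> / 2 * ((norm xs)\<^sup>2 + (norm ys)\<^sup>2) * (J t / t\<^sup>2))) \<longlongrightarrow> 0) at_top"
      by (intro tendsto_mult_right_zero tendsto_add_zero)
    have E_le: "2 * C * E t / t\<^sup>2 \<le> 2 * C * (E t0 / t\<^sup>2 + \<theta> / 2 * ((norm xs)\<^sup>2 + (norm ys)\<^sup>2) * (J t / t\<^sup>2))"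
      if "t0 \<le> t" for t
    proof -
      have "s powr (\<beta> + 1) = s\<^sup>2 * s powr (\<beta> - 1)" if "t0 \<le> s" for s
        using that t0' powr_add[of s 2 "\<beta> - 1"] by (simp add: powr_numeral add.commute)
      then have "integral {t0..t} (\<lambda>t. t powr (\<beta> + 1) * eps t) = J t"
        unfolding J_def by (intro integral_cong) auto
      then have "E t \<le> E t0 + \<theta> / 2 * ((norm xs)\<^sup>2 + (norm ys)\<^sup>2) * J t"
        using energy[OF that] W_int_nonneg[of t] unfolding int_R E_def W_def by simp
      then have "2 * C * E t / t\<^sup>2 \<le> 2 * C * (E t0 + \<theta> / 2 * ((norm xs)\<^sup>2 + (norm ys)\<^sup>2) * J t) / t\<^sup>2"
        using C by (intro divide_right_mono mult_left_mono) auto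
      then show ?thesis by (simp only: times_divide_eq_right[symmetric] add_divide_distrib)
    qed
    have to_0: "(k \<longlongrightarrow> 0) at_top"
      if "\<And>t. t0 \<le> t \<Longrightarrow> 0 \<le> k t" "\<And>t. t0 \<le> t \<Longrightarrow> t\<^sup>2 * k t \<le> 2 * C * E t" for k
    proof (rule tendsto_sandwich[OF _ _ tendsto_const upper])
      show "\<forall>\<^sub>F t in at_top. 0 \<le> k t"
        using eventually_ge_at_top[of t0] by eventually_elim (rule that(1))
      show "\<forall>\<^sub>F t in at_top. k t \<le> 2 * C * (E t0 / t\<^sup>2 + \<theta> / 2 * ((norm xs)\<^sup>2 + (norm ys)\<^sup>2) * (J t / t\<^sup>2))"
        using eventually_ge_at_top[of t0]
      proof eventually_elim
        case (elim t)
        then have "k t \<le> 2 * C * E t / t\<^sup>2" using that(2)[of t] t0' by (simp add: field_simps)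
        then show ?case using E_le[OF elim] by linarith
      qed
    qed
    have powr2: "t\<^sup>2 * t powr \<beta> = t powr (\<beta> + 2)" if "t0 \<le> t" for t
      using that t0' by (simp add: powr_add powr_numeral)
    have velocity: "((\<lambda>t. norm (z t)) \<longlongrightarrow> 0) at_top" if "\<And>t. t0 \<le> t \<Longrightarrow> t\<^sup>2 * (norm (z t))\<^sup>2 \<le> 2 * C * E t"
      for z :: "real \<Rightarrow> 'z::real_normed_vector"
    proof -
      have "((\<lambda>t. (norm (z t))\<^sup>2) \<longlongrightarrow> 0) at_top" using that by (intro to_0) auto
      from tendsto_real_sqrt[OF this] show ?thesis by simp
    qed
    have weighted: "((\<lambda>t. t powr \<beta> * k t) \<longlongrightarrow> 0) at_top"
      if "\<And>t. t0 \<le> t \<Longrightarrow> 0 \<le> k t" "\<And>t. t0 \<le> t \<Longrightarrow> t powr (\<beta> + 2) * k t \<le> 2 * C * E t" for k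
      using that by (intro to_0) (auto simp: powr2 simp flip: mult.assoc)
    have wgap: "((\<lambda>t. t powr \<beta> * gap t) \<longlongrightarrow> 0) at_top"
      by (intro weighted gap_nonneg E_control(1))
    have "(gap \<longlongrightarrow> 0) at_top"
    proof (rule tendsto_sandwich[OF _ _ tendsto_const wgap])
      show "\<forall>\<^sub>F t in at_top. 0 \<le> gap t"
        using eventually_ge_at_top[of t0] by eventually_elim (rule gap_nonneg)
      show "\<forall>\<^sub>F t in at_top. gap t \<le> t powr \<beta> * gap t"
        using eventually_ge_at_top[of t0]
      proof eventually_elim
        case (elim t)
        have "1 \<le> t powr \<beta>" using elim t0 \<beta> by (intro ge_one_powr_ge_zero) auto
        then show ?case using mult_right_mono[of 1 "t powr \<beta>" "gap t"] gap_nonneg[OF elim] by simp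
      qed
    qed
    moreover have "gap \<in> o[at_top](\<lambda>t. t powr (- \<beta>))"
    proof (rule smalloI_tendsto)
      show "((\<lambda>t. gap t / t powr (- \<beta>)) \<longlongrightarrow> 0) at_top"
        using wgap by (simp add: powr_minus divide_inverse mult.commute)
      show "\<forall>\<^sub>F t in at_top. t powr (- \<beta>) \<noteq> 0"
        using eventually_gt_at_top[of 0] by eventually_elim simp
    qed
    ultimately show ?thesis
      using E_control by (intro conjI impI smallo_of_weighted_square weighted velocity) auto
  qed
  show ?thesis
    using part1 part2 unfolding gap_def[abs_def] by blast
qed

end
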